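(* Let $A \in M_m(\mathbb{C})$ and let $\{h_1, \ldots, h_k\}$ be the set of real parts of eigenvalues of $A$, where $h_1 < h_2 < \cdots < h_k$. Let $A = D + N$ be the Jordan-Chevalley decomposition of $A$ into its commuting diagonalizable and nilpotent parts ($D$ and $N$, respectively). For $1 \le j \le k$, let $F_j$ be the orthogonal projection onto the subspace of $\mathbb{C}^m$ spanned by the eigenvectors of $D$ corresponding to eigenvalues with real part less than or equal to $h_j$, and set $F_0 := 0$. Then the following assertions hold, where $t$ ranges over positive real numbers: (i) $\lim_{t \to \infty} |e^{tA}|^{\frac{1}{t}} = \sum_{j=1}^k e^{h_j} (F_j - F_{j-1})$. (ii) For every $1 \le j \le k$, a non-zero vector $\vec{x} \in \mathbb{C}^m$ is in $\mathrm{ran}(F_j) \setminus \mathrm{ran}(F_{j-1})$ if and only if $\lim_{t \to \infty} \|e^{tA} \vec{x}\|^{\frac{1}{t}} = e^{h_j}$. (iii) For every $1 \le j \le k$, the set $\mathrm{ran}(F_j) \setminus \mathrm{ran}(F_{j-1})$ is invariant under the action of $e^{sA}$ for every $s \ge 0$.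
   Context: $M_m(\mathbb{C})$ is the set of $m \times m$ complex matrices acting on $\mathbb{C}^m$ with its standard inner product and Euclidean norm $\|\cdot\|$. For $T \in M_m(\mathbb{C})$, $|T| := \sqrt{T^*T}$, and powers of positive-semidefinite matrices are taken via the functional calculus. $\mathrm{ran}(T)$ denotes the range of $T$ in $\mathbb{C}^m$. Convergence of matrices is in norm. A set $S \subseteq \mathbb{C}^m$ is invariant under $B$ if $B\vec{x} \in S$ for every $\vec{x} \in S$. *)

theory Defs
  imports "HOL-Analysis.Analysis"
begin

(* On complex^'m^'m the library's "*" and "^" act entrywise, and the class-based "exp" is not
   available; hence the following two definitions in terms of the matrix product "**". *)

primrec mat_pow :: "complex^'m^'m \<Rightarrow> nat \<Rightarrow> complex^'m^'m" where
  "mat_pow A 0 = mat 1"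
| "mat_pow A (Suc n) = A ** mat_pow A n"

definition mat_exp :: "complex^'m^'m \<Rightarrow> complex^'m^'m" where
  "mat_exp A = (\<Sum>n. (1 / fact n) *\<^sub>R mat_pow A n)"

definition conj_transpose :: "complex^'m^'m \<Rightarrow> complex^'m^'m" where
  "conj_transpose A = (\<chi> i j. cnj (A $ j $ i))"

definition eigenvector :: "complex^'m^'m \<Rightarrow> complex^'m \<Rightarrow> complex \<Rightarrow> bool" where
  "eigenvector A v c \<longleftrightarrow> v \<noteq> 0 \<and> A *v v = c *s v"

definition eigenvalues :: "complex^'m^'m \<Rightarrow> complex set" where
  "eigenvalues A = {c. \<exists>v. eigenvector A v c}"

definition diagonalizable :: "complex^'m^'m \<Rightarrow> bool" where
  "diagonalizable A \<longleftrightarrow>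
     (\<exists>P L :: complex^'m^'m. invertible P \<and> (\<forall>i j. i \<noteq> j \<longrightarrow> L $ i $ j = 0) \<and> A = P ** L ** matrix_inv P)"

definition nilpotent :: "complex^'m^'m \<Rightarrow> bool" where
  "nilpotent A \<longleftrightarrow> (\<exists>n. mat_pow A n = 0)"

definition jordan_chevalley ::
    "complex^'m^'m \<Rightarrow> complex^'m^'m \<Rightarrow> complex^'m^'m \<Rightarrow> bool" where
  "jordan_chevalley A D N \<longleftrightarrow>
     A = D + N \<and> D ** N = N ** D \<and> diagonalizable D \<and> nilpotent N"

abbreviation mat_range :: "complex^'m^'m \<Rightarrow> (complex^'m) set" where
  "mat_range A \<equiv> range ((*v) A)"

(* The orthogonal projection onto a complex linear subspace S: the unique self-adjoint
   idempotent with range S. Only meaningful when S is closed under complex scalars. *)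
definition orth_proj :: "(complex^'m) set \<Rightarrow> complex^'m^'m" where
  "orth_proj S = (THE P. P ** P = P \<and> conj_transpose P = P \<and> mat_range P = S)"

(* Functional calculus of a Hermitian matrix via its spectral decomposition
   T = (SUM c. c * E_c), where E_c is the orthogonal projection onto the eigenspace of c.
   The eigenvalues of a Hermitian matrix are real, so Re loses nothing. *)
definition fun_calc :: "(real \<Rightarrow> real) \<Rightarrow> complex^'m^'m \<Rightarrow> complex^'m^'m" where
  "fun_calc f T = (\<Sum>c\<in>eigenvalues T. f (Re c) *\<^sub>R orth_proj {v. T *v v = c *s v})"

definition mat_abs :: "complex^'m^'m \<Rightarrow> complex^'m^'m" where
  "mat_abs T = fun_calc sqrt (conj_transpose T ** T)"

(* Positive real powers r of a positive-semidefinite matrix; 0 powr r = 0 is the right value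
   at the eigenvalue 0. *)
definition mat_powr :: "complex^'m^'m \<Rightarrow> real \<Rightarrow> complex^'m^'m" where
  "mat_powr T r = fun_calc (\<lambda>x. x powr r) T"

(* vec.span is the span over the complex numbers; plain span would be the real span. *)
definition spectral_subspace :: "complex^'m^'m \<Rightarrow> real \<Rightarrow> (complex^'m) set" where
  "spectral_subspace D r = vec.span {v. \<exists>c. Re c \<le> r \<and> eigenvector D v c}"

end

theory Submission
  imports Defs "HOL-Real_Asymp.Real_Asymp"
begin

text \<open>
  Put \<open>E = exp (t A)\<close> and \<open>G = (E\<^sup>-\<^sup>1)\<^sup>*\<close>, and let \<open>V\<^sub>j\<close> be the range of \<open>F\<^sub>j\<close>. If \<open>x \<in> V\<^sub>j\<close>, then \<open>E x\<close> grows at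
  most like \<open>exp (t h\<^sub>j)\<close>; dually, if \<open>y\<close> is orthogonal to \<open>V\<^sub>j\<^sub>-\<^sub>1\<close>, then \<open>G y\<close> decays at least like
  \<open>exp (- t h\<^sub>j)\<close>, because \<open>E\<^sup>-\<^sup>1\<close> preserves \<open>V\<^sub>j\<^sub>-\<^sub>1\<close> and decays on the remaining eigenvectors of \<open>D\<close>.
  The pairing of \<open>E x\<close> with \<open>G y\<close> equals that of \<open>x\<close> with \<open>y\<close>, so the second bound turns into a lower
  bound for \<open>E x\<close> when \<open>x\<close> is not in \<open>V\<^sub>j\<^sub>-\<^sub>1\<close>. For \<open>x\<close> in \<open>V\<^sub>j\<close> and orthogonal to \<open>V\<^sub>j\<^sub>-\<^sub>1\<close>, the two
  bounds control the components of \<open>x\<close> in the eigenspaces of \<open>E\<^sup>* E\<close>: all but an exponentially small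
  part belongs to eigenvalues near \<open>exp (2 t h\<^sub>j)\<close>, so the \<open>t\<close>-th root of the absolute value of \<open>E\<close> sends
  \<open>x\<close> to almost \<open>exp (h\<^sub>j) x\<close>. Such vectors span the whole space. Only the real inner product
  (the real part of the Hermitian one) is used: on complex subspaces both define the same orthogonality.
\<close>

subsection \<open>Complex matrices acting on vectors\<close>

lemma scaleR_matrix_vector: "(r *\<^sub>R M) *v v = r *\<^sub>R (M *v v)"
  for M :: "complex^'m^'m"
  by (simp add: matrix_vector_mult_def vec_eq_iff scaleR_sum_right)

lemma matrix_vector_scaleR: "A *v (r *\<^sub>R v) = r *\<^sub>R (A *v v)" for A :: "complex^'m^'m"
  by (simp add: linear_scale)

lemma matrix_scaleR_right: "A ** (r *\<^sub>R B) = r *\<^sub>R (A ** B)"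
  for A B :: "complex^'m^'m"
  by (simp add: matrix_matrix_mult_def vec_eq_iff scaleR_sum_right)

lemma matrix_scaleR_left: "(r *\<^sub>R A) ** B = r *\<^sub>R (A ** B)"
  for A B :: "complex^'m^'m"
  by (simp add: matrix_matrix_mult_def vec_eq_iff scaleR_sum_right)

lemma matrix_add_rdistrib: "(B + C) ** A = B ** A + C ** A"
  for A B C :: "complex^'m^'m"
  by (simp add: matrix_matrix_mult_def vec_eq_iff sum.distrib ring_distribs)

lemma matrix_sum_right: "A ** sum f S = (\<Sum>i\<in>S. A ** f i)"
  for A :: "complex^'m^'m"
  by (induction S rule: infinite_finite_induct)
     (auto simp: matrix_add_ldistrib)

lemma matrix_uminus_left: "(- A) ** B = - (A ** B)" and matrix_uminus_right: "A ** (- B) = - (A ** B)"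
  for A B :: "complex^'m^'m"
  by (simp_all add: matrix_matrix_mult_def vec_eq_iff sum_negf)

lemma uminus_matrix_vector: "(- A) *v v = - (A *v v)" for A :: "complex^'m^'m"
  by (simp add: matrix_vector_mult_def vec_eq_iff sum_negf)

lemma matrix_vector_sum: "A *v (\<Sum>i\<in>S. f i) = (\<Sum>i\<in>S. A *v f i)"
  for A :: "complex^'m^'m"
  by (simp add: linear_sum[OF matrix_vector_mul_linear])

lemma sum_matrix_vector: "(\<Sum>i\<in>S. f i) *v v = (\<Sum>i\<in>S. f i *v v)"
  for f :: "'i \<Rightarrow> complex^'m^'m"
  by (induction S rule: infinite_finite_induct) (auto simp: matrix_vector_mult_add_rdistrib)

lemma matrix_vector_scale: "A *v (c *s v) = c *s (A *v v)" for A :: "complex^'m^'m"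
  by (simp add: matrix_vector_mult_def vec_eq_iff sum_distrib_left mult_ac)

lemma scaleR_eq_scale: "r *\<^sub>R v = complex_of_real r *s v" for v :: "complex^'m"
  by (simp add: vec_eq_iff scaleR_conv_of_real[where 'a=complex])

lemma norm_complex_scale: "norm (c *s v) = norm c * norm v" for v :: "complex^'m"
  by (simp add: norm_vec_def L2_set_def norm_mult power_mult_distrib real_sqrt_mult flip: sum_distrib_left)

lemma bounded_linear_matrix_vector_left: "bounded_linear (\<lambda>M :: complex^'m^'m. M *v v)"
  by (intro linear_conv_bounded_linear[THEN iffD1] linearI)
     (auto simp: matrix_vector_mult_add_rdistrib scaleR_matrix_vector)

lemma bounded_linear_matrix_mult_left: "bounded_linear (\<lambda>M :: complex^'m^'m. M ** A)" for A :: "complex^'m^'m"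
  by (intro linear_conv_bounded_linear[THEN iffD1] linearI)
     (auto simp: matrix_add_rdistrib matrix_scaleR_left)

lemma bounded_linear_matrix_mult_right: "bounded_linear (\<lambda>M :: complex^'m^'m. A ** M)" for A :: "complex^'m^'m"
  by (intro linear_conv_bounded_linear[THEN iffD1] linearI)
     (auto simp: matrix_add_ldistrib matrix_scaleR_right)

lemma bounded_linear_entry: "bounded_linear (\<lambda>M :: complex^'m^'m. M $ i $ j)"
  by (intro linear_conv_bounded_linear[THEN iffD1] linearI) auto

subsection \<open>The matrix exponential\<close>

definition exp_term :: "complex^'m^'m \<Rightarrow> nat \<Rightarrow> complex^'m^'m" where
  "exp_term X n = (1 / fact n) *\<^sub>R mat_pow X n"

text \<open>The entrywise l1 norm, chosen because it is submultiplicative and bounds both every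
  single entry and the Euclidean norm; a scalar exponential series thus dominates the matrix
  one.\<close>

definition entry_sum :: "complex^'m^'m \<Rightarrow> real" where
  "entry_sum X = (\<Sum>i\<in>UNIV. \<Sum>j\<in>UNIV. norm (X $ i $ j))"

lemma norm_mat_pow_entry: "norm (mat_pow X n $ i $ j) \<le> entry_sum X ^ n"
proof (induction n arbitrary: i j)
  case 0
  then show ?case by (simp add: mat_def)
next
  case (Suc n)
  have nn: "0 \<le> entry_sum X" by (simp add: entry_sum_def sum_nonneg)
  have "norm (mat_pow X (Suc n) $ i $ j) \<le> (\<Sum>k\<in>UNIV. norm (X $ i $ k * mat_pow X n $ k $ j))"
    by (simp add: matrix_matrix_mult_def norm_sum)
  also have "\<dots> \<le> (\<Sum>k\<in>UNIV. norm (X $ i $ k) * entry_sum X ^ n)"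
    by (intro sum_mono) (simp add: norm_mult mult_left_mono Suc)
  also have "\<dots> = (\<Sum>k\<in>UNIV. norm (X $ i $ k)) * entry_sum X ^ n"
    by (simp add: sum_distrib_right)
  also have "\<dots> \<le> entry_sum X * entry_sum X ^ n"
    using nn unfolding entry_sum_def
    by (intro mult_right_mono member_le_sum) (auto intro: sum_nonneg)
  finally show ?case by simp
qed

text \<open>Absolute convergence is kept entry by entry because the scalar Cauchy product in
  \<open>mat_exp_add\<close> asks for it in this form.\<close>

lemma summable_norm_exp_term_entry: "summable (\<lambda>n. norm (exp_term X n $ i $ j))"
proof (rule summable_comparison_test')
  show "summable (\<lambda>n. inverse (fact n) * entry_sum X ^ n)"
    by (rule summable_exp)
  show "norm (norm (exp_term X n $ i $ j)) \<le> inverse (fact n) * entry_sum X ^ n" if "n \<ge> 0" for n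
    using norm_mat_pow_entry[of X n i j] by (simp add: exp_term_def divide_simps)
qed

lemma norm_matrix_le_entries: "norm X \<le> entry_sum X" for X :: "complex^'m^'m"
proof -
  have "norm X \<le> (\<Sum>i\<in>UNIV. norm (X $ i))"
    unfolding norm_vec_def[of X] by (simp add: L2_set_le_sum)
  also have "\<dots> \<le> entry_sum X"
    unfolding entry_sum_def by (intro sum_mono) (simp add: norm_vec_def L2_set_le_sum)
  finally show ?thesis .
qed

lemma exp_term_sums: "exp_term X sums mat_exp X"
proof -
  have "summable (\<lambda>n. norm (exp_term X n))"
  proof (rule summable_comparison_test')
    show "summable (\<lambda>n. entry_sum (exp_term X n))"
      unfolding entry_sum_def by (intro summable_sum summable_norm_exp_term_entry)
    show "norm (norm (exp_term X n)) \<le> entry_sum (exp_term X n)" for n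
      by (simp add: norm_matrix_le_entries)
  qed
  then have "summable (exp_term X)" by (rule summable_norm_cancel)
  then show ?thesis
    unfolding mat_exp_def exp_term_def[abs_def] by (rule summable_sums)
qed

lemma mat_pow_commute: "X ** Y = Y ** X \<Longrightarrow> mat_pow X n ** Y = Y ** mat_pow X n"
  by (induction n) (simp_all, metis matrix_mul_assoc)

lemma exp_term_commute: "X ** Y = Y ** X \<Longrightarrow> exp_term X n ** Y = Y ** exp_term X n"
  by (simp add: exp_term_def matrix_scaleR_left matrix_scaleR_right mat_pow_commute)

lemma mult_exp_term: "X ** exp_term X n = real (Suc n) *\<^sub>R exp_term X (Suc n)"
  by (simp add: exp_term_def matrix_scaleR_right del: mult_Suc of_nat_Suc)

lemma exp_term_0: "exp_term X 0 = mat 1"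
  by (simp add: exp_term_def)

text \<open>Multiplying the identity for \<open>n\<close> by \<open>X + Y\<close> avoids binomial
  coefficients: \<open>X\<close> raises the first index, \<open>Y\<close> the second, and the
  resulting factors \<open>i\<close> and \<open>Suc n - i\<close> add up to
  \<open>Suc n\<close>.\<close>

lemma exp_term_add:
  assumes comm: "X ** Y = Y ** X"
  shows "exp_term (X + Y) n = (\<Sum>i\<le>n. exp_term X i ** exp_term Y (n - i))"
proof (induction n)
  case 0
  show ?case by (simp add: exp_term_0)
next
  case (Suc n)
  let ?S = "\<lambda>i j. exp_term X i ** exp_term Y j"
  have X: "X ** ?S i j = real (Suc i) *\<^sub>R ?S (Suc i) j" for i j
    by (simp add: matrix_mul_assoc mult_exp_term matrix_scaleR_left)
  have Y: "Y ** ?S i j = real (Suc j) *\<^sub>R ?S i (Suc j)" for i j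
    by (metis exp_term_commute[OF comm] matrix_mul_assoc mult_exp_term matrix_scaleR_right)
  have "real (Suc n) *\<^sub>R exp_term (X + Y) (Suc n) = (X + Y) ** (\<Sum>i\<le>n. ?S i (n - i))"
    by (metis Suc.IH mult_exp_term)
  also have "\<dots> = (\<Sum>i\<le>n. real (Suc i) *\<^sub>R ?S (Suc i) (n - i))
               + (\<Sum>i\<le>n. real (Suc n - i) *\<^sub>R ?S i (Suc n - i))"
    by (simp add: matrix_add_rdistrib matrix_sum_right X Y Suc_diff_le sum.distrib del: of_nat_Suc)
  \<comment> \<open>Both sums are brought to the range up to \<open>Suc n\<close>: the term added
    here at \<open>i = 0\<close> and the one added below at \<open>i = Suc n\<close> have
    coefficient 0.\<close>
  also have "(\<Sum>i\<le>n. real (Suc i) *\<^sub>R ?S (Suc i) (n - i))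
           = (\<Sum>i\<le>Suc n. real i *\<^sub>R ?S i (Suc n - i))"
    by (subst sum.atMost_Suc_shift) simp
  also have "(\<Sum>i\<le>n. real (Suc n - i) *\<^sub>R ?S i (Suc n - i))
           = (\<Sum>i\<le>Suc n. real (Suc n - i) *\<^sub>R ?S i (Suc n - i))"
    by simp
  also have "(\<Sum>i\<le>Suc n. real i *\<^sub>R ?S i (Suc n - i))
           + (\<Sum>i\<le>Suc n. real (Suc n - i) *\<^sub>R ?S i (Suc n - i))
           = (\<Sum>i\<le>Suc n. real (Suc n) *\<^sub>R ?S i (Suc n - i))"
    by (simp flip: sum.distrib scaleR_add_left of_nat_add)
  also have "\<dots> = real (Suc n) *\<^sub>R (\<Sum>i\<le>Suc n. ?S i (Suc n - i))"
    by (simp only: scaleR_right.sum)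
  finally show ?case
    by (simp del: sum.cl_ivl_Suc)
qed

text \<open>An entry of the product is a finite sum over \<open>k\<close> of products of two scalar
  series. The Cauchy product treats each of them, and summing over \<open>k\<close> reassembles the
  convolution of \<open>exp_term_add\<close>.\<close>

lemma mat_exp_add:
  assumes "X ** Y = Y ** X"
  shows "mat_exp (X + Y) = mat_exp X ** mat_exp Y"
proof -
  have entry: "(\<lambda>n. exp_term Z n $ i $ j) sums (mat_exp Z $ i $ j)" for Z :: "complex^'m^'m" and i j
    by (rule bounded_linear.sums[OF bounded_linear_entry exp_term_sums])
  have "(mat_exp X ** mat_exp Y) $ i $ j = mat_exp (X + Y) $ i $ j" for i j
  proof -
    have "(\<lambda>n. \<Sum>a\<le>n. exp_term X a $ i $ k * exp_term Y (n - a) $ k $ j)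
            sums (mat_exp X $ i $ k * mat_exp Y $ k $ j)" for k
      using Cauchy_product_sums[OF summable_norm_exp_term_entry[of X i k] summable_norm_exp_term_entry[of Y k j]]
      by (simp add: sums_unique[OF entry, symmetric])
    then have "(\<lambda>n. \<Sum>k\<in>UNIV. \<Sum>a\<le>n. exp_term X a $ i $ k * exp_term Y (n - a) $ k $ j)
            sums (\<Sum>k\<in>UNIV. mat_exp X $ i $ k * mat_exp Y $ k $ j)"
      by (intro sums_sum)
    moreover have "(\<lambda>n. \<Sum>k\<in>UNIV. \<Sum>a\<le>n. exp_term X a $ i $ k * exp_term Y (n - a) $ k $ j)
        = (\<lambda>n. exp_term (X + Y) n $ i $ j)"
      by (subst sum.swap) (simp add: exp_term_add[OF assms] matrix_matrix_mult_def)
    ultimately show ?thesis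
      using entry[of "X + Y" i j] sums_unique2 by (fastforce simp: matrix_matrix_mult_def)
  qed
  then show ?thesis by (simp add: vec_eq_iff)
qed

lemma mat_exp_commute: "X ** Y = Y ** X \<Longrightarrow> mat_exp X ** Y = Y ** mat_exp X"
  using bounded_linear.sums[OF bounded_linear_matrix_mult_left[of Y] exp_term_sums[of X]]
    bounded_linear.sums[OF bounded_linear_matrix_mult_right[of Y] exp_term_sums[of X]]
  by (simp add: exp_term_commute sums_unique2)

lemma mat_exp_0: "mat_exp (0 :: complex^'m^'m) = mat 1"
proof -
  have "exp_term (0 :: complex^'m^'m) n = (if n = 0 then mat 1 else 0)" for n
    by (cases n) (simp_all add: exp_term_def)
  then have "exp_term (0 :: complex^'m^'m) = (\<lambda>n. if n = 0 then mat 1 else 0)"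
    by (simp add: fun_eq_iff)
  then have "exp_term 0 sums (mat 1 :: complex^'m^'m)"
    using sums_single[of 0 "\<lambda>_. mat 1 :: complex^'m^'m"] by simp
  then show ?thesis using exp_term_sums sums_unique2 by blast
qed

lemma mat_exp_neg: "mat_exp (- X) ** mat_exp X = mat 1" "mat_exp X ** mat_exp (- X) = mat 1"
  by (simp_all add: matrix_uminus_left matrix_uminus_right mat_exp_0 flip: mat_exp_add)

lemma mat_exp_eigenvector:
  assumes "X *v v = c *s v"
  shows "mat_exp X *v v = exp c *s v"
proof -
  have pow: "mat_pow X n *v v = c ^ n *s v" for n
    by (induction n) (simp_all add: matrix_vector_scale assms flip: matrix_vector_mul_assoc)
  have eq: "exp_term X n *v v = (c ^ n /\<^sub>R fact n) *s v" for n
    by (simp add: exp_term_def scaleR_matrix_vector pow vec_eq_iff divide_inverse)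
  have "linear (\<lambda>a::complex. a *s v)"
    by (intro linearI) (simp_all add: vec_eq_iff ring_distribs)
  then have "bounded_linear (\<lambda>a::complex. a *s v)"
    by (simp add: linear_conv_bounded_linear)
  from bounded_linear.sums[OF this exp_converges[of c]]
    bounded_linear.sums[OF bounded_linear_matrix_vector_left[of v] exp_term_sums[of X]]
  show ?thesis by (simp add: eq sums_unique2)
qed

lemma mat_pow_scaleR: "mat_pow (t *\<^sub>R X) n = t ^ n *\<^sub>R mat_pow X n"
  by (induction n) (simp_all add: matrix_scaleR_left matrix_scaleR_right)

lemma mat_pow_eq_0_mono:
  assumes "mat_pow X n = 0" "n \<le> k"
  shows "mat_pow X k = 0"
  using assms(2,1) by (induction rule: dec_induct) simp_all

text \<open>The series stops, so the nilpotent part contributes only a polynomial in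
  \<open>t\<close>, which \<open>exp (- e * t)\<close> with \<open>e > 0\<close> outweighs.\<close>

lemma mat_exp_nilpotent:
  assumes "mat_pow X n = 0"
  shows "mat_exp (t *\<^sub>R X) = (\<Sum>i<n. (t ^ i / fact i) *\<^sub>R mat_pow X i)"
proof -
  have "exp_term (t *\<^sub>R X) sums (\<Sum>i<n. exp_term (t *\<^sub>R X) i)"
    by (rule sums_finite) (auto simp: exp_term_def mat_pow_scaleR mat_pow_eq_0_mono[OF assms])
  then show ?thesis
    using exp_term_sums[of "t *\<^sub>R X"] sums_unique2 by (force simp: exp_term_def mat_pow_scaleR)
qed

subsection \<open>Orthogonal projections and the spectral theorem\<close>

lemma inner_conj_transpose: "(A *v x) \<bullet> y = x \<bullet> (conj_transpose A *v y)"
proof -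
  have *: "a \<bullet> b = Re (a * cnj b)" for a b :: complex
    by (simp add: inner_complex_def)
  have "(A *v x) \<bullet> y = (\<Sum>i\<in>UNIV. \<Sum>j\<in>UNIV. Re (A $ i $ j * x $ j * cnj (y $ i)))"
    by (simp add: inner_vec_def matrix_vector_mult_def * sum_distrib_right)
  also have "\<dots> = (\<Sum>j\<in>UNIV. \<Sum>i\<in>UNIV. Re (A $ i $ j * x $ j * cnj (y $ i)))"
    by (rule sum.swap)
  also have "\<dots> = x \<bullet> (conj_transpose A *v y)"
    by (simp add: inner_vec_def matrix_vector_mult_def conj_transpose_def * sum_distrib_left mult_ac)
  finally show ?thesis .
qed

lemma conj_transpose_conj_transpose: "conj_transpose (conj_transpose A) = A"
  by (simp add: conj_transpose_def vec_eq_iff)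

lemma conj_transpose_mult: "conj_transpose (A ** B) = conj_transpose B ** conj_transpose A"
  by (simp add: conj_transpose_def matrix_matrix_mult_def vec_eq_iff mult.commute)

lemma conj_transpose_mat_1: "conj_transpose (mat 1) = mat 1"
  by (auto simp: conj_transpose_def mat_def vec_eq_iff)

lemma hermitian_iff: "conj_transpose H = H \<longleftrightarrow> (\<forall>x y. (H *v x) \<bullet> y = x \<bullet> (H *v y))"
proof
  assume *: "\<forall>x y. (H *v x) \<bullet> y = x \<bullet> (H *v y)"
  have "x \<bullet> (conj_transpose H *v y) = x \<bullet> (H *v y)" for x y
    using * by (simp flip: inner_conj_transpose)
  then have "conj_transpose H *v y = H *v y" for y
    by (metis vector_eq_rdot inner_commute)
  then show "conj_transpose H = H" by (simp add: matrix_eq)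
qed (metis inner_conj_transpose)

lemma inner_scale_left: "(c *s x) \<bullet> y = x \<bullet> (cnj c *s y)" for x y :: "complex^'m"
  by (simp add: inner_vec_def inner_complex_def algebra_simps)

section \<open>Complex subspaces and their orthogonal projections\<close>

lemma subspace_if_complex_subspace:
  "vec.subspace S \<Longrightarrow> subspace S" for S :: "(complex^'m) set"
  by (auto simp: vec.subspace_def subspace_def scaleR_eq_scale)

lemma orthogonal_point_unique:
  fixes S :: "(complex^'m) set"
  assumes "vec.subspace S" "a \<in> S" "b \<in> S" "\<And>w. w \<in> S \<Longrightarrow> (x - a) \<bullet> w = 0" "\<And>w. w \<in> S \<Longrightarrow> (x - b) \<bullet> w = 0"
  shows "a = b"
proof -
  have "a - b \<in> S" using assms by (intro vec.subspace_diff)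
  with assms(4,5)[of "a - b"] have "(a - b) \<bullet> (a - b) = 0"
    by (simp add: inner_diff_left)
  then show ?thesis by simp
qed

lemma hermitian_idempotent_orthogonal:
  assumes "P ** P = P" "conj_transpose P = P" "w \<in> mat_range P"
  shows "(x - P *v x) \<bullet> w = 0"
proof -
  from assms(3) obtain u where "w = P *v u" by auto
  then have "P *v w = w" using assms(1) by (simp add: matrix_vector_mul_assoc)
  moreover have "(P *v x) \<bullet> w = x \<bullet> (P *v w)" using assms(2) hermitian_iff by blast
  ultimately show ?thesis by (simp add: inner_diff_left)
qed

text \<open>Orthogonal decomposition over the reals yields the foot point \<open>p x\<close>; its
  uniqueness makes \<open>p\<close> additive and complex homogeneous, hence a matrix.\<close>

lemma orth_proj_exists:
  fixes S :: "(complex^'m) set"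
  assumes S: "vec.subspace S"
  shows "\<exists>P. P ** P = P \<and> conj_transpose P = P \<and> mat_range P = S"
proof -
  have sp: "span S = S"
    using subspace_if_complex_subspace[OF S] by (simp add: span_eq_iff)
  have "\<exists>p. p \<in> S \<and> (\<forall>w\<in>S. (x - p) \<bullet> w = 0)" for x
  proof -
    obtain y z where "y \<in> span S" "\<And>w. w \<in> span S \<Longrightarrow> orthogonal z w" "x = y + z"
      using orthogonal_subspace_decomp_exists[of S x] by metis
    then show ?thesis by (intro exI[of _ y]) (auto simp: sp orthogonal_def)
  qed
  then obtain p where p: "\<And>x. p x \<in> S" "\<And>x w. w \<in> S \<Longrightarrow> (x - p x) \<bullet> w = 0"
    by metis
  have eqI: "p x = a" if "a \<in> S" "\<And>w. w \<in> S \<Longrightarrow> (x - a) \<bullet> w = 0" for x a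
    by (rule orthogonal_point_unique[OF S p(1) that(1) p(2) that(2)])
  have add: "p (x + y) = p x + p y" for x y
  proof (rule eqI)
    show "(x + y - (p x + p y)) \<bullet> w = 0" if "w \<in> S" for w
      using p(2)[OF that, of x] p(2)[OF that, of y] by (simp add: inner_diff_left inner_add_left)
  qed (simp add: p(1) vec.subspace_add S)
  \<comment> \<open>Moving \<open>c\<close> across the real inner product replaces \<open>w\<close>
    by \<open>cnj c *s w\<close>, which stays in \<open>S\<close>; closure under complex scalars
    enters here.\<close>
  have scale: "p (c *s x) = c *s p x" for c x
  proof (rule eqI)
    show "(c *s x - c *s p x) \<bullet> w = 0" if "w \<in> S" for w
      using p(2)[OF vec.subspace_scale[OF S that], of x "cnj c"]
      by (simp only: vec.scale_right_diff_distrib[symmetric] inner_scale_left)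
  qed (simp add: p(1) vec.subspace_scale S)
  have "Vector_Spaces.linear (*s) (*s) p"
    by (simp add: Vector_Spaces.linear_iff vec.vector_space_axioms add scale)
  then have P: "matrix p *v x = p x" for x by (rule matrix_works)
  have fixed: "p x = x" if "x \<in> S" for x by (rule eqI) (use that in auto)
  have sym: "p x \<bullet> y = x \<bullet> p y" for x y
    using p(2)[OF p(1), of x y] p(2)[OF p(1), of y x]
    by (simp add: inner_diff_left) (metis inner_commute)
  have "matrix p ** matrix p = matrix p"
    by (simp add: matrix_eq P fixed p(1) flip: matrix_vector_mul_assoc)
  moreover have "conj_transpose (matrix p) = matrix p"
    by (simp add: hermitian_iff P sym)
  moreover have "mat_range (matrix p) = S"
    using p(1) by (auto simp: P) (metis fixed rangeI)
  ultimately show ?thesis by blast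
qed

text \<open>A Hermitian idempotent with range \<open>S\<close> leaves residuals orthogonal to
  \<open>S\<close>, and each \<open>x\<close> has only one such point in \<open>S\<close>; hence the
  definite description in \<open>orth_proj\<close> denotes.\<close>

lemma orth_proj:
  fixes S :: "(complex^'m) set"
  assumes S: "vec.subspace S"
  shows orth_proj_idem: "orth_proj S ** orth_proj S = orth_proj S"
    and orth_proj_hermitian: "conj_transpose (orth_proj S) = orth_proj S"
    and range_orth_proj: "mat_range (orth_proj S) = S"
proof -
  have "\<exists>!P. P ** P = P \<and> conj_transpose P = P \<and> mat_range P = S"
  proof (rule ex_ex1I[OF orth_proj_exists[OF S]])
    fix P Q :: "complex^'m^'m"
    assume P: "P ** P = P \<and> conj_transpose P = P \<and> mat_range P = S"
      and Q: "Q ** Q = Q \<and> conj_transpose Q = Q \<and> mat_range Q = S"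
    have "P *v x = Q *v x" for x
    proof (rule orthogonal_point_unique[OF S])
      show "P *v x \<in> S" "Q *v x \<in> S" using P Q by auto
    qed (use P Q hermitian_idempotent_orthogonal in blast)+
    then show "P = Q" by (simp add: matrix_eq)
  qed
  from theI'[OF this, folded orth_proj_def]
  show "orth_proj S ** orth_proj S = orth_proj S" "conj_transpose (orth_proj S) = orth_proj S"
    "mat_range (orth_proj S) = S" by auto
qed

lemma orth_proj_in: "vec.subspace S \<Longrightarrow> orth_proj S *v x \<in> S"
  using range_orth_proj by blast

lemma orth_proj_orthogonal: "vec.subspace S \<Longrightarrow> w \<in> S \<Longrightarrow> (x - orth_proj S *v x) \<bullet> w = 0"
  by (rule hermitian_idempotent_orthogonal) (simp_all add: orth_proj)

lemma orth_proj_eqI: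
  assumes "vec.subspace S" "a \<in> S" "\<And>w. w \<in> S \<Longrightarrow> (x - a) \<bullet> w = 0"
  shows "orth_proj S *v x = a"
  using assms orth_proj_in orth_proj_orthogonal by (intro orthogonal_point_unique[of S _ _ x]) blast+

lemma orth_proj_inside: "vec.subspace S \<Longrightarrow> x \<in> S \<Longrightarrow> orth_proj S *v x = x"
  by (rule orth_proj_eqI) auto

lemma orth_proj_outside:
  "vec.subspace S \<Longrightarrow> (\<And>w. w \<in> S \<Longrightarrow> x \<bullet> w = 0) \<Longrightarrow> orth_proj S *v x = 0"
  by (rule orth_proj_eqI) (auto simp: vec.subspace_0)

text \<open>A maximiser of the quadratic form on the unit sphere of an invariant subspace is an
  eigenvector.\<close>
lemma hermitian_eigenvector_in_subspace:
  fixes H :: "complex^'m^'m"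
  assumes H: "conj_transpose H = H" and W: "subspace W" and inv: "\<And>w. w \<in> W \<Longrightarrow> H *v w \<in> W"
    and x: "x \<in> W" "x \<noteq> 0"
  shows "\<exists>v\<in>W. \<exists>c. eigenvector H v c"
proof -
  have sym: "(H *v x) \<bullet> y = x \<bullet> (H *v y)" for x y using H hermitian_iff by blast
  let ?K = "W \<inter> sphere 0 1"
  have "compact ?K" using W by (simp add: closed_subspace closed_Int_compact)
  moreover have "x /\<^sub>R norm x \<in> ?K" using x W by (simp add: subspace_scale)
  moreover have "continuous_on ?K (\<lambda>v. v \<bullet> (H *v v))"
    by (intro continuous_intros linear_continuous_on) (simp add: linear_conv_bounded_linear[symmetric])
  ultimately obtain v where v: "v \<in> ?K" and max: "\<And>y. y \<in> ?K \<Longrightarrow> y \<bullet> (H *v y) \<le> v \<bullet> (H *v v)"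
    using continuous_attains_sup[of ?K "\<lambda>v. v \<bullet> (H *v v)"] by blast
  define l where "l = v \<bullet> (H *v v)"
  \<comment> \<open>\<open>g\<close> is the residual of the eigenvalue equation, and
    \<open>q\<close> is the form of \<open>l - H\<close>, nonnegative on \<open>W\<close> and zero
    at the maximiser \<open>v\<close>. A nonzero \<open>g\<close> would make \<open>q\<close>
    negative close to \<open>v\<close>.\<close>
  define g where "g = l *\<^sub>R v - H *v v"
  define q where "q = (\<lambda>y. l * (y \<bullet> y) - y \<bullet> (H *v y))"
  have nv: "v \<bullet> v = 1" using v by (simp add: norm_eq_1)
  have q0: "q y \<ge> 0" if "y \<in> W" for y
  proof (cases "y = 0")
    case False
    let ?u = "y /\<^sub>R norm y"
    have "?u \<in> ?K" using False that W by (simp add: subspace_scale)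
    then have "?u \<bullet> (H *v ?u) \<le> l" using max l_def by blast
    moreover have "H *v ?u = (H *v y) /\<^sub>R norm y" by (rule matrix_vector_scaleR)
    ultimately have "y \<bullet> (H *v y) / (norm y)\<^sup>2 \<le> l"
      by (simp add: power2_eq_square divide_inverse mult_ac)
    then show ?thesis using False by (simp add: q_def divide_simps power2_norm_eq_inner mult_ac)
  qed (simp add: q_def)
  have gW: "g \<in> W" unfolding g_def using v W inv by (intro subspace_diff subspace_scale) auto
  have qs: "q (v + s *\<^sub>R g) = 2 * s * (g \<bullet> g) + s\<^sup>2 * q g" for s
  proof -
    have "v \<bullet> (H *v g) = g \<bullet> (H *v v)" using sym[of v g] by (simp add: inner_commute)
    moreover have "g \<bullet> g = l * (g \<bullet> v) - g \<bullet> (H *v v)"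
      by (metis g_def inner_diff_right inner_scaleR_right)
    then have "2 * s * (l * (g \<bullet> v)) = 2 * s * (g \<bullet> g + g \<bullet> (H *v v))" by simp
    ultimately show ?thesis
      by (simp add: q_def matrix_vector_right_distrib matrix_vector_scaleR inner_add_left inner_add_right
        nv inner_commute[of v g] power2_eq_square algebra_simps flip: l_def)
  qed
  have "g \<bullet> g = 0"
  proof (rule ccontr)
    assume "g \<bullet> g \<noteq> 0"
    then have gg: "g \<bullet> g > 0" by simp
    have qg: "q g \<ge> 0" using q0 gW by blast
    \<comment> \<open>With this \<open>s\<close> the quadratic term takes back at most half of the
      negative linear term; the \<open>+ 1\<close> keeps the denominator positive when
      \<open>q g = 0\<close>.\<close>
    define s where "s = - (g \<bullet> g) / (q g + 1)"
    have "v + s *\<^sub>R g \<in> W" using v gW W by (intro subspace_add subspace_scale) auto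
    then have "0 \<le> 2 * s * (g \<bullet> g) + s\<^sup>2 * q g" using q0 qs by metis
    also have "s\<^sup>2 * q g \<le> s\<^sup>2 * (q g + 1)" by (simp add: algebra_simps)
    also have "s\<^sup>2 * (q g + 1) = - s * (g \<bullet> g)"
      using qg by (simp add: s_def power2_eq_square divide_simps)
    also have "2 * s * (g \<bullet> g) + - s * (g \<bullet> g) = s * (g \<bullet> g)" by simp
    also have "\<dots> < 0" using gg qg by (simp add: s_def divide_simps mult_neg_pos)
    finally show False by simp
  qed
  then have "H *v v = complex_of_real l *s v" by (simp add: g_def flip: scaleR_eq_scale)
  moreover have "v \<noteq> 0" using nv by auto
  ultimately have "eigenvector H v (complex_of_real l)" by (simp add: eigenvector_def)
  then show ?thesis using v by blast
qed

section \<open>Eigenspaces and functional calculus of a Hermitian matrix\<close>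

abbreviation eigenspace :: "complex^'m^'m \<Rightarrow> complex \<Rightarrow> (complex^'m) set" where
  "eigenspace T c \<equiv> {v. T *v v = c *s v}"

lemma subspace_eigenspace: "vec.subspace (eigenspace T c)"
  by (auto simp: vec.subspace_def matrix_vector_right_distrib vec.scale_right_distrib matrix_vector_scale
      vec.scale_left_commute)

context
  fixes H :: "complex^'m^'m"
  assumes H: "conj_transpose H = H"
begin

lemma hermitian_inner: "(H *v x) \<bullet> y = x \<bullet> (H *v y)"
  using H hermitian_iff by blast

text \<open>The real inner product detects the imaginary part of \<open>c\<close> when symmetry is
  tested on the pair \<open>u\<close> and \<open>\<i> *s u\<close>.\<close>

lemma hermitian_eigenvalue_real:
  assumes "c \<in> eigenvalues H"
  shows "complex_of_real (Re c) = c"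
proof -
  obtain u where u: "u \<noteq> 0" "H *v u = c *s u"
    using assms by (auto simp: eigenvalues_def eigenvector_def)
  have *: "(a *s u) \<bullet> u = Re a * (u \<bullet> u)" for a
    by (simp add: inner_vec_def inner_complex_def sum_distrib_left algebra_simps)
  have "(H *v u) \<bullet> (\<i> *s u) = u \<bullet> (H *v (\<i> *s u))" by (rule hermitian_inner)
  then have "(c *s u) \<bullet> (\<i> *s u) = u \<bullet> ((\<i> * c) *s u)"
    by (simp add: matrix_vector_scale u)
  then have "(c *s u) \<bullet> (\<i> *s u) = ((\<i> * c) *s u) \<bullet> u" by (simp add: inner_commute)
  moreover have "(c *s u) \<bullet> (\<i> *s u) = ((- \<i> * c) *s u) \<bullet> u"
    by (simp add: inner_commute[of "c *s u"] inner_scale_left[of \<i>] inner_commute[of u])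
  ultimately have "Im c = 0" using u by (simp add: *)
  then show ?thesis by (simp add: complex_eq_iff)
qed

lemma eigenspace_scaleR:
  assumes "c \<in> eigenvalues H" "v \<in> eigenspace H c"
  shows "H *v v = Re c *\<^sub>R v"
  using assms hermitian_eigenvalue_real by (simp add: scaleR_eq_scale)

lemma eigenspaces_orthogonal:
  assumes "c \<in> eigenvalues H" "d \<in> eigenvalues H" "c \<noteq> d" "u \<in> eigenspace H c" "v \<in> eigenspace H d"
  shows "u \<bullet> v = 0"
proof -
  have "Re c * (u \<bullet> v) = Re d * (u \<bullet> v)"
    using hermitian_inner[of u v] eigenspace_scaleR[OF assms(1,4)] eigenspace_scaleR[OF assms(2,5)] by simp
  moreover have "Re c \<noteq> Re d" using assms hermitian_eigenvalue_real by metis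
  ultimately show ?thesis by simp
qed

text \<open>One eigenvector per eigenvalue gives a family of nonzero, pairwise orthogonal vectors;
  it is injective and independent, hence finite.\<close>

lemma finite_hermitian_eigenvalues: "finite (eigenvalues H)"
proof -
  have "\<forall>c\<in>eigenvalues H. \<exists>v. v \<noteq> 0 \<and> v \<in> eigenspace H c"
    by (auto simp: eigenvalues_def eigenvector_def)
  then obtain v where v: "\<And>c. c \<in> eigenvalues H \<Longrightarrow> v c \<noteq> 0 \<and> v c \<in> eigenspace H c"
    by metis
  have orth: "v c \<bullet> v d = 0" if "c \<in> eigenvalues H" "d \<in> eigenvalues H" "c \<noteq> d" for c d
    using eigenspaces_orthogonal v that by blast
  have "pairwise orthogonal (v ` eigenvalues H)"
    unfolding pairwise_def orthogonal_def using orth by blast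
  moreover have "0 \<notin> v ` eigenvalues H" using v by force
  ultimately have "finite (v ` eigenvalues H)"
    using pairwise_orthogonal_independent independent_bound by blast
  moreover have "inj_on v (eigenvalues H)"
    unfolding inj_on_def using orth v by (metis inner_eq_zero_iff)
  ultimately show ?thesis using finite_imageD by blast
qed

definition spectral_part :: "complex \<Rightarrow> complex^'m \<Rightarrow> complex^'m" where
  "spectral_part c x = orth_proj (eigenspace H c) *v x"

lemma spectral_part_in: "spectral_part c x \<in> eigenspace H c"
  unfolding spectral_part_def by (rule orth_proj_in[OF subspace_eigenspace])

lemma spectral_part_eigenspace:
  assumes "c \<in> eigenvalues H" "d \<in> eigenvalues H" "v \<in> eigenspace H c"
  shows "spectral_part d v = (if d = c then v else 0)"
  unfolding spectral_part_def
  using assms orth_proj_inside[OF subspace_eigenspace] orth_proj_outside[OF subspace_eigenspace, of H d v]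
    eigenspaces_orthogonal[of c d v] by auto

lemma spectral_parts_orthogonal:
  "c \<in> eigenvalues H \<Longrightarrow> d \<in> eigenvalues H \<Longrightarrow> c \<noteq> d \<Longrightarrow> spectral_part c x \<bullet> spectral_part d y = 0"
  using eigenspaces_orthogonal spectral_part_in by blast

text \<open>The remainder \<open>?z\<close> is orthogonal to all eigenvectors. Such vectors form an
  invariant subspace \<open>W\<close>; if \<open>?z\<close> were nonzero, \<open>W\<close> would
  contain an eigenvector, which would be orthogonal to itself.\<close>

theorem spectral_decomposition: "(\<Sum>c\<in>eigenvalues H. spectral_part c x) = x"
proof -
  define W where "W = {w. \<forall>v c. eigenvector H v c \<longrightarrow> w \<bullet> v = 0}"
  let ?z = "x - (\<Sum>c\<in>eigenvalues H. spectral_part c x)"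
  have "?z \<bullet> v = 0" if "eigenvector H v c" for v c
  proof -
    have v: "v \<in> eigenspace H c" and c: "c \<in> eigenvalues H"
      using that by (auto simp: eigenvector_def eigenvalues_def)
    have "(\<Sum>d\<in>eigenvalues H. spectral_part d x) \<bullet> v = (\<Sum>d\<in>eigenvalues H. if d = c then spectral_part c x \<bullet> v else 0)"
      unfolding inner_sum_left using eigenspaces_orthogonal[OF _ c _ spectral_part_in v] by (intro sum.cong) auto
    also have "\<dots> = spectral_part c x \<bullet> v" using c finite_hermitian_eigenvalues by simp
    also have "\<dots> = x \<bullet> v"
      using orth_proj_orthogonal[OF subspace_eigenspace v, of x] by (simp add: spectral_part_def inner_diff_left)
    finally show ?thesis by (simp add: inner_diff_left)
  qed
  then have "?z \<in> W" by (auto simp: W_def)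
  moreover have "subspace W" by (auto simp: W_def subspace_def inner_add_left)
  moreover have "H *v w \<in> W" if "w \<in> W" for w
  proof -
    have "(H *v w) \<bullet> v = 0" if v: "eigenvector H v c" for v c
    proof -
      have "(H *v w) \<bullet> v = Re c * (w \<bullet> v)"
        using hermitian_inner[of w v] eigenspace_scaleR[of c v] v
        by (force simp: eigenvector_def eigenvalues_def)
      also have "w \<bullet> v = 0" using \<open>w \<in> W\<close> v by (auto simp: W_def)
      finally show ?thesis by simp
    qed
    then show ?thesis by (auto simp: W_def)
  qed
  moreover have "v = 0" if "v \<in> W" "eigenvector H v c" for v c
    using that by (auto simp: W_def)
  ultimately have "?z = 0"
    using hermitian_eigenvector_in_subspace[OF H, of W ?z] by (metis eigenvector_def)
  then show ?thesis by simp
qed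

text \<open>Two uses of this evaluate \<open>mat_powr\<close> of \<open>mat_abs\<close> on an
  eigenvector, without determining the whole spectrum of the absolute value.\<close>

lemma fun_calc_eigenspace:
  assumes "c \<in> eigenvalues H" "v \<in> eigenspace H c"
  shows "fun_calc f H *v v = f (Re c) *\<^sub>R v"
proof -
  have "fun_calc f H *v v = (\<Sum>d\<in>eigenvalues H. f (Re d) *\<^sub>R spectral_part d v)"
    by (simp add: fun_calc_def sum_matrix_vector scaleR_matrix_vector spectral_part_def)
  also have "\<dots> = (\<Sum>d\<in>eigenvalues H. if d = c then f (Re c) *\<^sub>R v else 0)"
    using spectral_part_eigenspace[OF assms(1) _ assms(2)] by (intro sum.cong) auto
  finally show ?thesis using assms finite_hermitian_eigenvalues by simp
qed

lemma fun_calc_hermitian: "conj_transpose (fun_calc f H) = fun_calc f H"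
proof -
  have "(orth_proj (eigenspace H c) *v x) \<bullet> y = x \<bullet> (orth_proj (eigenspace H c) *v y)" for c x y
    using orth_proj_hermitian[OF subspace_eigenspace] hermitian_iff by blast
  then show ?thesis
    by (simp add: hermitian_iff fun_calc_def sum_matrix_vector scaleR_matrix_vector inner_sum_left inner_sum_right)
qed

lemma norm_sum_spectral_parts:
  "(norm (\<Sum>c\<in>eigenvalues H. f c *\<^sub>R spectral_part c x))\<^sup>2 = (\<Sum>c\<in>eigenvalues H. (f c)\<^sup>2 * (norm (spectral_part c x))\<^sup>2)"
proof -
  have "pairwise (\<lambda>c d. orthogonal (f c *\<^sub>R spectral_part c x) (f d *\<^sub>R spectral_part d x)) (eigenvalues H)"
    by (auto simp: pairwise_def orthogonal_def spectral_parts_orthogonal)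
  from norm_sum_Pythagorean[OF finite_hermitian_eigenvalues this]
  show ?thesis by (simp add: power_mult_distrib)
qed

lemma inner_spectral_part:
  "c \<in> eigenvalues H \<Longrightarrow> spectral_part c x \<bullet> x = (norm (spectral_part c x))\<^sup>2"
  using orth_proj_orthogonal[OF subspace_eigenspace spectral_part_in[of c x], of x]
  by (simp add: spectral_part_def inner_diff_left inner_diff_right power2_norm_eq_inner inner_commute)

end

subsection \<open>Deviation of powers of the absolute value from a scalar\<close>

text \<open>Here \<open>exp (2 * t * s)\<close> stands for an eigenvalue of
  \<open>E\<^sup>* E\<close>, so \<open>exp s\<close> is the one of the \<open>t\<close>-th root of
  the absolute value. The three summands serve the cases of \<open>s\<close> within \<open>e\<close>
  of \<open>h\<close>, above, and below.\<close>

lemma deviation_bound_scalar: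
  fixes h e s t :: real
  assumes "e > 0" "t \<ge> 1"
  shows "(exp s - exp h)\<^sup>2 \<le> (exp (h + e) - exp (h - e))\<^sup>2
    + exp (2 * (h + e)) * (exp (- t * (h + e)))\<^sup>2 * exp (2 * t * s)
    + exp (2 * h) * (exp (t * (h - e)))\<^sup>2 * (1 / exp (2 * t * s))"
proof -
  have sq: "(exp x)\<^sup>2 = exp (2 * x)" for x :: real by (simp add: exp_double)
  have nonneg: "0 \<le> exp (2 * (h + e)) * (exp (- t * (h + e)))\<^sup>2 * exp (2 * t * s)"
    "0 \<le> exp (2 * h) * (exp (t * (h - e)))\<^sup>2 * (1 / exp (2 * t * s))" by simp_all
  have up: "exp (2 * (h + e)) * (exp (- t * (h + e)))\<^sup>2 * exp (2 * t * s)
      = exp (2 * (h + e) + 2 * t * (s - (h + e)))"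
    by (simp add: sq algebra_simps flip: exp_add)
  have low: "exp (2 * h) * (exp (t * (h - e)))\<^sup>2 * (1 / exp (2 * t * s))
      = exp (2 * h + 2 * t * (h - e - s))"
    by (simp only: sq exp_minus[symmetric] inverse_eq_divide[symmetric] exp_add[symmetric])
      (simp add: algebra_simps)
  consider "s \<ge> h + e" | "s \<le> h - e" | "h - e \<le> s" "s \<le> h + e" by linarith
  then show ?thesis
  proof cases
    case 1
    have "(exp s - exp h)\<^sup>2 \<le> (exp s)\<^sup>2"
      using 1 assms by (intro power_mono) auto
    \<comment> \<open>As \<open>t \<ge> 1\<close>, giving the nonnegative excess
      \<open>s - (h + e)\<close> the factor \<open>t\<close> can only enlarge the exponent.\<close>
    also have "\<dots> \<le> exp (2 * (h + e) + 2 * t * (s - (h + e)))"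
      using 1 mult_right_mono[OF assms(2), of "s - (h + e)"] by (simp add: sq)
    finally show ?thesis using nonneg up zero_le_power2[of "exp (h + e) - exp (h - e)"] by linarith
  next
    case 2
    have "(exp s - exp h)\<^sup>2 = (exp h - exp s)\<^sup>2" by (simp add: power2_commute)
    also have "\<dots> \<le> (exp h)\<^sup>2"
      using 2 assms by (intro power_mono) auto
    also have "\<dots> \<le> exp (2 * h + 2 * t * (h - e - s))"
      using 2 assms by (simp add: sq)
    finally show ?thesis using nonneg low zero_le_power2[of "exp (h + e) - exp (h - e)"] by linarith
  next
    case 3
    then have "exp (h - e) \<le> exp s" "exp s \<le> exp (h + e)" by simp_all
    moreover have "exp (h - e) \<le> exp h" "exp h \<le> exp (h + e)" using assms by simp_all
    ultimately have "\<bar>exp s - exp h\<bar> \<le> \<bar>exp (h + e) - exp (h - e)\<bar>" by linarith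
    then have "(exp s - exp h)\<^sup>2 \<le> (exp (h + e) - exp (h - e))\<^sup>2" by (simp add: abs_le_square_iff)
    then show ?thesis using nonneg by linarith
  qed
qed

text \<open>A large value of the deviation comes from spectral components of \<open>E\<^sup>* E\<close> that are controlled
  either by \<open>E x\<close> (large eigenvalues) or by \<open>(E\<^sup>-\<^sup>1)\<^sup>* x\<close> (small eigenvalues).\<close>
lemma deviation_bound:
  fixes E E' :: "complex^'m^'m" and h e t :: real
  assumes inv: "E ** E' = mat 1" "E' ** E = mat 1" and "e > 0" "t \<ge> 1"
  shows "(norm (mat_powr (mat_abs E) (1 / t) *v x - exp h *\<^sub>R x))\<^sup>2 \<le>
    (exp (h + e) - exp (h - e))\<^sup>2 * (norm x)\<^sup>2
    + exp (2 * (h + e)) * (norm (exp (- t * (h + e)) *\<^sub>R (E *v x)))\<^sup>2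
    + exp (2 * h) * (norm (exp (t * (h - e)) *\<^sub>R (conj_transpose E' *v x)))\<^sup>2"
proof -
  define H where "H = conj_transpose E ** E"
  have H: "conj_transpose H = H"
    by (simp add: H_def conj_transpose_mult conj_transpose_conj_transpose)
  define M where "M = mat_abs E"
  have M_def': "M = fun_calc sqrt H" by (simp add: M_def mat_abs_def H_def)
  have M: "conj_transpose M = M" unfolding M_def' by (rule fun_calc_hermitian[OF H])
  define T where "T = mat_powr M (1 / t)"
  define G where "G = conj_transpose E'"
  \<comment> \<open>In the orthogonal components \<open>q c\<close> all three norms of the claim
    become sums over eigenvalues with the same weights \<open>w c\<close>, so a scalar comparison
    suffices.\<close>
  define q where "q = (\<lambda>c. spectral_part H c x)"
  let ?ev = "eigenvalues H"
  have sum_q: "(\<Sum>c\<in>?ev. q c) = x"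
    unfolding q_def by (rule spectral_decomposition[OF H])
  have q: "H *v q c = c *s q c" for c
    using spectral_part_in[OF H, of c x] by (simp add: q_def)
  have GE: "G ** conj_transpose E = mat 1"
    by (simp add: G_def inv conj_transpose_mat_1 flip: conj_transpose_mult)
  have Hxx: "(H *v y) \<bullet> y = (norm (E *v y))\<^sup>2" for y
    by (simp add: H_def inner_conj_transpose conj_transpose_conj_transpose power2_norm_eq_inner
        flip: matrix_vector_mul_assoc)
  have E_inj: "E *v y \<noteq> 0" if "y \<noteq> 0" for y
    using that inv by (metis matrix_vector_mul_assoc matrix_vector_mul_lid matrix_vector_mult_0_right)
  \<comment> \<open>Invertibility of \<open>E\<close> makes \<open>H\<close> positive definite; the
    reciprocal and the logarithm of \<open>Re c\<close> below rest on this.\<close>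
  have pos: "Re c > 0" if c: "c \<in> ?ev" for c
  proof -
    obtain v where v: "v \<noteq> 0" "H *v v = c *s v"
      using c by (auto simp: eigenvalues_def eigenvector_def)
    then have "Re c * (v \<bullet> v) = (norm (E *v v))\<^sup>2"
      using eigenspace_scaleR[OF H c, of v] Hxx[of v] by simp
    also have "\<dots> > 0" using E_inj v by simp
    finally show ?thesis using v by (auto dest: zero_less_mult_pos2)
  qed
  have Hq: "H *v q c = Re c *\<^sub>R q c" if "c \<in> ?ev" for c
    using eigenspace_scaleR[OF H that] q by simp
  have Mq: "M *v q c = sqrt (Re c) *\<^sub>R q c" if "c \<in> ?ev" for c
    unfolding M_def' using fun_calc_eigenspace[OF H that] q by simp
  have Tq: "T *v q c = (sqrt (Re c) powr (1 / t)) *\<^sub>R q c" if c: "c \<in> ?ev" for c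
  proof (cases "q c = 0")
    case False
    have "M *v q c = complex_of_real (sqrt (Re c)) *s q c"
      using Mq[OF c] by (simp add: scaleR_eq_scale)
    then have "complex_of_real (sqrt (Re c)) \<in> eigenvalues M" "q c \<in> eigenspace M (complex_of_real (sqrt (Re c)))"
      using False by (auto simp: eigenvalues_def eigenvector_def)
    from fun_calc_eigenspace[OF M this] show ?thesis by (simp add: T_def mat_powr_def)
  qed simp
  \<comment> \<open>\<open>G\<close> inverts the adjoint of \<open>E\<close>, so
    \<open>E' ** G\<close> inverts \<open>H\<close>.\<close>
  have Gq: "E' *v (G *v q c) = (1 / Re c) *\<^sub>R q c" if c: "c \<in> ?ev" for c
  proof -
    have "G *v (H *v q c) = E *v q c"
      unfolding H_def by (simp add: matrix_vector_mul_assoc matrix_mul_assoc GE)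
    then have "E' *v (G *v (H *v q c)) = q c"
      by (simp add: matrix_vector_mul_assoc inv)
    then have "Re c *\<^sub>R (E' *v (G *v q c)) = q c"
      by (simp add: Hq[OF c] matrix_vector_scaleR)
    then show ?thesis using pos[OF c] by (metis less_irrefl scaleR_one scaleR_scaleR times_divide_eq_left mult_1 divide_self)
  qed
  define w where "w = (\<lambda>c. (norm (q c))\<^sup>2)"
  have wnn: "w c \<ge> 0" for c by (simp add: w_def)
  have qx: "q c \<bullet> x = w c" if "c \<in> ?ev" for c
    using inner_spectral_part[OF H that] by (simp add: q_def w_def)
  have norm_x: "(norm x)\<^sup>2 = (\<Sum>c\<in>?ev. w c)"
    using norm_sum_spectral_parts[OF H, of "\<lambda>_. 1" x] spectral_decomposition[OF H, of x] by (simp add: w_def q_def)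
  have norm_E: "(norm (E *v x))\<^sup>2 = (\<Sum>c\<in>?ev. Re c * w c)"
  proof -
    have "(norm (E *v x))\<^sup>2 = (H *v (\<Sum>c\<in>?ev. q c)) \<bullet> x" by (simp add: sum_q Hxx)
    also have "\<dots> = (\<Sum>c\<in>?ev. Re c * w c)"
      by (simp add: matrix_vector_sum Hq inner_sum_left qx)
    finally show ?thesis .
  qed
  have norm_G: "(norm (G *v x))\<^sup>2 = (\<Sum>c\<in>?ev. 1 / Re c * w c)"
  proof -
    have "(norm (G *v x))\<^sup>2 = (E' *v (G *v (\<Sum>c\<in>?ev. q c))) \<bullet> x"
      by (simp add: sum_q inner_conj_transpose G_def power2_norm_eq_inner)
    also have "\<dots> = (\<Sum>c\<in>?ev. 1 / Re c * w c)"
      by (simp add: matrix_vector_sum Gq inner_sum_left qx)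
    finally show ?thesis .
  qed
  have "T *v x - exp h *\<^sub>R x = T *v (\<Sum>c\<in>?ev. q c) - exp h *\<^sub>R (\<Sum>c\<in>?ev. q c)"
    by (simp add: sum_q)
  also have "\<dots> = (\<Sum>c\<in>?ev. (sqrt (Re c) powr (1 / t) - exp h) *\<^sub>R q c)"
    by (simp add: matrix_vector_sum Tq scaleR_sum_right scaleR_diff_left sum_subtractf)
  finally have "(norm (T *v x - exp h *\<^sub>R x))\<^sup>2 = (\<Sum>c\<in>?ev. (sqrt (Re c) powr (1 / t) - exp h)\<^sup>2 * w c)"
    using norm_sum_spectral_parts[OF H, of "\<lambda>c. sqrt (Re c) powr (1 / t) - exp h" x] by (simp add: w_def q_def)
  also have "\<dots> \<le> (\<Sum>c\<in>?ev. ((exp (h + e) - exp (h - e))\<^sup>2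
      + exp (2 * (h + e)) * (exp (- t * (h + e)))\<^sup>2 * Re c
      + exp (2 * h) * (exp (t * (h - e)))\<^sup>2 * (1 / Re c)) * w c)"
  proof (intro sum_mono mult_right_mono wnn)
    fix c assume c: "c \<in> ?ev"
    define s where "s = ln (Re c) / (2 * t)"
    have "exp (2 * t * s) = Re c" using pos[OF c] assms by (simp add: s_def)
    moreover have "sqrt (Re c) powr (1 / t) = exp s"
      using pos[OF c] by (simp add: s_def powr_def ln_sqrt)
    ultimately show "(sqrt (Re c) powr (1 / t) - exp h)\<^sup>2 \<le> (exp (h + e) - exp (h - e))\<^sup>2
      + exp (2 * (h + e)) * (exp (- t * (h + e)))\<^sup>2 * Re c
      + exp (2 * h) * (exp (t * (h - e)))\<^sup>2 * (1 / Re c)"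
      using deviation_bound_scalar[OF assms(3,4), of s h] by simp
  qed
  also have "\<dots> = (exp (h + e) - exp (h - e))\<^sup>2 * (\<Sum>c\<in>?ev. w c)
      + exp (2 * (h + e)) * (exp (- t * (h + e)))\<^sup>2 * (\<Sum>c\<in>?ev. Re c * w c)
      + exp (2 * h) * (exp (t * (h - e)))\<^sup>2 * (\<Sum>c\<in>?ev. 1 / Re c * w c)"
    unfolding distrib_right sum.distrib sum_distrib_left by (simp only: mult.assoc)
  also have "\<dots> = (exp (h + e) - exp (h - e))\<^sup>2 * (norm x)\<^sup>2
    + exp (2 * (h + e)) * (norm (exp (- t * (h + e)) *\<^sub>R (E *v x)))\<^sup>2
    + exp (2 * h) * (norm (exp (t * (h - e)) *\<^sub>R (G *v x)))\<^sup>2"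
    by (simp add: norm_x norm_E norm_G power_mult_distrib)
  finally show ?thesis by (simp add: T_def M_def G_def)
qed

subsection \<open>Growth of the exponential\<close>

text \<open>A predicate on eigenvalues, not a bound, so that \<open>Re c \<le> r\<close> and
  \<open>Re c < r\<close> share one notation and one invariance lemma.\<close>

abbreviation eigenspan :: "complex^'m^'m \<Rightarrow> (complex \<Rightarrow> bool) \<Rightarrow> (complex^'m) set" where
  "eigenspan D P \<equiv> vec.span {v. \<exists>c. P c \<and> eigenvector D v c}"

lemma eigenspan_mono:
  "(\<And>v c. eigenvector D v c \<Longrightarrow> P c \<Longrightarrow> Q c) \<Longrightarrow> eigenspan D P \<subseteq> eigenspan D Q"
  by (intro vec.span_mono) blast

lemma eigenspan_memI: "D *v v = c *s v \<Longrightarrow> P c \<Longrightarrow> v \<in> eigenspan D P"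
  by (cases "v = 0") (auto simp: eigenvector_def vec.span_zero intro!: vec.span_base)

lemma matrix_vector_axis: "(M *v axis j 1) $ i = M $ i $ j" for M :: "complex^'m^'m"
  by (simp add: matrix_vector_mult_def axis_def if_distrib cong: if_cong)

lemma commuting_preserves_eigenspace:
  fixes D M :: "complex^'m^'m"
  assumes "M ** D = D ** M" "D *v v = c *s v"
  shows "D *v (M *v v) = c *s (M *v v)"
proof -
  have "D *v (M *v v) = M *v (D *v v)" by (simp only: matrix_vector_mul_assoc assms(1))
  then show ?thesis by (simp only: assms(2) matrix_vector_scale)
qed

text \<open>Expand \<open>x\<close> in the columns of \<open>P\<close>. Some \<open>y i\<close> may
  vanish, so the conclusion states the equation and not \<open>eigenvector\<close>.\<close>

lemma diagonalizable_eigendecomposition: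
  fixes D :: "complex^'m^'m"
  assumes "diagonalizable D"
  obtains y and c :: "'m \<Rightarrow> complex" where "x = (\<Sum>i\<in>UNIV. y i)" "\<And>i. D *v y i = c i *s y i"
proof -
  obtain P L :: "complex^'m^'m" where P: "invertible P" and L: "\<And>i j. i \<noteq> j \<Longrightarrow> L $ i $ j = 0"
    and D: "D = P ** L ** matrix_inv P"
    using assms by (auto simp: diagonalizable_def)
  have inv: "P ** matrix_inv P = mat 1 \<and> matrix_inv P ** P = mat 1"
    using P unfolding invertible_def matrix_inv_def by (rule someI_ex)
  define z where "z = matrix_inv P *v x"
  define y where "y = (\<lambda>i. P *v (z $ i *s axis i 1))"
  have "x = P *v z" by (simp add: z_def matrix_vector_mul_assoc inv)
  also have "\<dots> = P *v (\<Sum>i\<in>UNIV. z $ i *s axis i 1)" by (simp add: basis_expansion)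
  finally have 1: "x = (\<Sum>i\<in>UNIV. y i)" by (simp add: y_def matrix_vector_sum)
  have "(L *v axis i 1) $ j = (L $ i $ i *s axis i 1) $ j" for i j
    unfolding matrix_vector_axis using L by (auto simp: axis_def)
  then have La: "L *v axis i 1 = L $ i $ i *s axis i 1" for i
    unfolding vec_eq_iff by blast
  have "D *v y i = L $ i $ i *s y i" for i
  proof -
    have "matrix_inv P *v y i = z $ i *s axis i 1" by (simp add: y_def matrix_vector_mul_assoc inv)
    then have "D *v y i = P *v (L *v (z $ i *s axis i 1))"
      by (simp add: D flip: matrix_vector_mul_assoc)
    also have "\<dots> = L $ i $ i *s y i"
      by (simp add: matrix_vector_scale La y_def vec.scale_left_commute)
    finally show ?thesis .
  qed
  then show ?thesis by (rule that[OF 1])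
qed

text \<open>This lets the growth bound for \<open>exp (t A)\<close> be applied to its inverse as
  well.\<close>

lemma jordan_chevalley_uminus:
  fixes A D N :: "complex^'m^'m"
  assumes "jordan_chevalley A D N"
  shows "jordan_chevalley (- A) (- D) (- N)"
proof -
  obtain P L :: "complex^'m^'m" where P: "invertible P" "\<forall>i j. i \<noteq> j \<longrightarrow> L $ i $ j = 0"
    "D = P ** L ** matrix_inv P"
    using assms by (auto simp: jordan_chevalley_def diagonalizable_def)
  then have "diagonalizable (- D)"
    unfolding diagonalizable_def
    by (intro exI[of _ P] exI[of _ "- L"]) (simp add: matrix_uminus_left matrix_uminus_right)
  moreover obtain n where "mat_pow N n = 0"
    using assms by (auto simp: jordan_chevalley_def nilpotent_def)
  then have "nilpotent (- N)"
    unfolding nilpotent_def using mat_pow_scaleR[of "-1" N n] by (intro exI[of _ n]) simp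
  ultimately show ?thesis
    using assms by (simp add: jordan_chevalley_def matrix_uminus_left matrix_uminus_right)
qed

text \<open>Apply \<open>N\<close> to \<open>v\<close> until the last nonzero vector:
  \<open>N\<close> kills it, and it still lies in the eigenspace of \<open>D\<close> because
  \<open>N\<close> and \<open>D\<close> commute, so \<open>A\<close> multiplies it by
  \<open>c\<close>.\<close>

lemma jordan_chevalley_eigenvalue:
  assumes JC: "jordan_chevalley A D N" and v: "eigenvector D v c"
  shows "c \<in> eigenvalues A"
proof -
  have A: "A = D + N" and comm: "N ** D = D ** N" using JC by (auto simp: jordan_chevalley_def)
  obtain n where "mat_pow N n = 0" using JC by (auto simp: jordan_chevalley_def nilpotent_def)
  then have ex: "\<exists>n. mat_pow N n *v v = 0" by (intro exI[of _ n]) simp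
  define m where "m = (LEAST n. mat_pow N n *v v = 0)"
  have m: "mat_pow N m *v v = 0" unfolding m_def using ex by (rule LeastI_ex)
  moreover have "mat_pow N 0 *v v \<noteq> 0" using v by (simp add: eigenvector_def)
  ultimately obtain i where i: "m = Suc i" by (metis not0_implies_Suc)
  let ?w = "mat_pow N i *v v"
  have "?w \<noteq> 0" using not_less_Least[of i "\<lambda>n. mat_pow N n *v v = 0"] i by (auto simp: m_def)
  moreover have "N *v ?w = 0" using m i by (simp add: matrix_vector_mul_assoc)
  moreover have "D *v ?w = c *s ?w"
    using v by (intro commuting_preserves_eigenspace[OF mat_pow_commute[OF comm]]) (simp add: eigenvector_def)
  ultimately show ?thesis
    by (auto simp: eigenvalues_def eigenvector_def A matrix_vector_mult_add_rdistrib)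
qed

text \<open>The exponential commutes with \<open>D\<close> and so preserves each of its eigenspaces.
  Negative \<open>s\<close> is used too, to return from the image to \<open>x\<close>.\<close>

lemma mat_exp_eigenspan:
  assumes JC: "jordan_chevalley A D N" and x: "x \<in> eigenspan D P"
  shows "mat_exp (s *\<^sub>R A) *v x \<in> eigenspan D P"
proof -
  let ?E = "mat_exp (s *\<^sub>R A)"
  have "A ** D = D ** A"
    using JC by (simp add: jordan_chevalley_def matrix_add_rdistrib matrix_add_ldistrib)
  then have comm: "?E ** D = D ** ?E"
    by (intro mat_exp_commute) (simp add: matrix_scaleR_left matrix_scaleR_right)
  have "eigenspan D P \<subseteq> {x. ?E *v x \<in> eigenspan D P}"
  proof (rule vec.span_minimal)
    show "vec.subspace {x. ?E *v x \<in> eigenspan D P}"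
      by (simp add: vec.subspace_def matrix_vector_right_distrib matrix_vector_scale
          vec.span_zero vec.span_add vec.span_scale)
    show "{v. \<exists>c. P c \<and> eigenvector D v c} \<subseteq> {x. ?E *v x \<in> eigenspan D P}"
    proof clarify
      fix v c assume "P c" "eigenvector D v c"
      then have "D *v (?E *v v) = c *s (?E *v v)"
        by (intro commuting_preserves_eigenspace[OF comm]) (simp add: eigenvector_def)
      then show "?E *v v \<in> eigenspan D P" using \<open>P c\<close> by (rule eigenspan_memI)
    qed
  qed
  with x show ?thesis by blast
qed

text \<open>The vectors with this limit form a complex subspace, so eigenvectors of \<open>D\<close>
  suffice. There the exponential is \<open>exp (t c)\<close> times a polynomial in \<open>t\<close>,
  and the margin \<open>e\<close> absorbs the polynomial.\<close>

lemma mat_exp_growth: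
  fixes A D N :: "complex^'m^'m"
  assumes JC: "jordan_chevalley A D N" and x: "x \<in> eigenspan D (\<lambda>c. Re c \<le> r)" and e: "e > 0"
  shows "((\<lambda>t. exp (- t * (r + e)) *\<^sub>R (mat_exp (t *\<^sub>R A) *v x)) \<longlongrightarrow> 0) at_top"
proof -
  define f where "f = (\<lambda>x t. exp (- t * (r + e)) *\<^sub>R (mat_exp (t *\<^sub>R A) *v x))"
  have "eigenspan D (\<lambda>c. Re c \<le> r) \<subseteq> {x. (f x \<longlongrightarrow> 0) at_top}"
  proof (rule vec.span_minimal)
    have "f (x + y) = (\<lambda>t. f x t + f y t)" for x y
      by (simp add: f_def fun_eq_iff matrix_vector_right_distrib scaleR_add_right)
    moreover have "f (c *s x) = (\<lambda>t. c *s f x t)" for c x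
      unfolding f_def fun_eq_iff matrix_vector_scale scaleR_eq_scale by (simp add: mult.commute)
    moreover have "((\<lambda>t. c *s g t) \<longlongrightarrow> 0) at_top" if "(g \<longlongrightarrow> 0) at_top" for c and g :: "real \<Rightarrow> complex^'m"
    proof -
      have "((\<lambda>t. norm c * norm (g t)) \<longlongrightarrow> 0) at_top"
        using tendsto_mult_right_zero[OF tendsto_norm_zero[OF that]] .
      then have "((\<lambda>t. norm (c *s g t)) \<longlongrightarrow> 0) at_top" by (simp only: norm_complex_scale)
      then show ?thesis by (rule tendsto_norm_zero_cancel)
    qed
    moreover have "f 0 = (\<lambda>t. 0)" by (simp add: f_def fun_eq_iff)
    ultimately show "vec.subspace {x. (f x \<longlongrightarrow> 0) at_top}"
      by (auto simp: vec.subspace_def intro: tendsto_add_zero)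
    show "{v. \<exists>c. Re c \<le> r \<and> eigenvector D v c} \<subseteq> {x. (f x \<longlongrightarrow> 0) at_top}"
    proof clarify
      fix v c assume c: "Re c \<le> r" and v: "eigenvector D v c"
      obtain n where n: "mat_pow N n = 0" using JC by (auto simp: jordan_chevalley_def nilpotent_def)
      have eq: "mat_exp (t *\<^sub>R A) *v v = exp (of_real t * c) *s (\<Sum>i<n. (t ^ i / fact i) *\<^sub>R (mat_pow N i *v v))" for t
      proof -
        have "(t *\<^sub>R D) *v v = (of_real t * c) *s v"
          using v by (simp add: eigenvector_def scaleR_matrix_vector scaleR_eq_scale)
        then have "mat_exp (t *\<^sub>R D) *v v = exp (of_real t * c) *s v"
          by (rule mat_exp_eigenvector)
        moreover have "mat_exp (t *\<^sub>R N + t *\<^sub>R D) = mat_exp (t *\<^sub>R N) ** mat_exp (t *\<^sub>R D)"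
          using JC by (intro mat_exp_add) (simp add: jordan_chevalley_def matrix_scaleR_left matrix_scaleR_right)
        moreover have "t *\<^sub>R A = t *\<^sub>R N + t *\<^sub>R D"
          using JC by (simp add: jordan_chevalley_def scaleR_add_right add.commute)
        ultimately show ?thesis
          by (simp add: mat_exp_nilpotent[OF n] sum_matrix_vector scaleR_matrix_vector matrix_vector_scale
              flip: matrix_vector_mul_assoc)
      qed
      show "(f v \<longlongrightarrow> 0) at_top"
      proof (rule Lim_null_comparison)
        show "\<forall>\<^sub>F t in at_top. norm (f v t) \<le> (\<Sum>i<n. (t ^ i * exp (- e * t)) * (norm (mat_pow N i *v v) / fact i))"
          using eventually_ge_at_top[of 0]
        proof eventually_elim
          case (elim t)
          have "norm (f v t) = exp (- t * (r + e)) * (exp (t * Re c) * norm (\<Sum>i<n. (t ^ i / fact i) *\<^sub>R (mat_pow N i *v v)))"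
            by (simp add: f_def eq norm_complex_scale)
          also have "\<dots> = exp (t * (Re c - r) - e * t) * norm (\<Sum>i<n. (t ^ i / fact i) *\<^sub>R (mat_pow N i *v v))"
            by (simp add: mult.assoc[symmetric] exp_add[symmetric] algebra_simps del: norm_sum)
          also have "\<dots> \<le> exp (- e * t) * (\<Sum>i<n. norm ((t ^ i / fact i) *\<^sub>R (mat_pow N i *v v)))"
            using c elim by (intro mult_mono norm_sum) (auto simp: mult_nonneg_nonpos)
          finally show ?case
            using elim by (simp add: sum_distrib_left mult_ac)
        qed
        have "((\<lambda>t. t ^ i * exp (- e * t)) \<longlongrightarrow> 0) at_top" for i using e by real_asymp
        then show "((\<lambda>t. \<Sum>i<n. (t ^ i * exp (- e * t)) * (norm (mat_pow N i *v v) / fact i)) \<longlongrightarrow> 0) at_top"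
          by (intro tendsto_null_sum tendsto_mult_left_zero)
      qed
    qed
  qed
  with x show ?thesis unfolding f_def by blast
qed

text \<open>The pairing of the left-hand side with a vector \<open>b\<close> only sees the component of \<open>b\<close> in the
  eigenvectors with real part at least \<open>r\<close>, on which \<open>exp (-t A)\<close> decays at the required rate.\<close>
lemma mat_exp_dual_growth:
  fixes A D N :: "complex^'m^'m"
  assumes JC: "jordan_chevalley A D N" and y: "\<And>w. w \<in> eigenspan D (\<lambda>c. Re c < r) \<Longrightarrow> y \<bullet> w = 0"
    and e: "e > 0"
  shows "((\<lambda>t. exp (t * (r - e)) *\<^sub>R (conj_transpose (mat_exp (t *\<^sub>R (- A))) *v y)) \<longlongrightarrow> 0) at_top"
proof (subst tendsto_componentwise_iff, intro ballI)
  fix b :: "complex^'m"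
  let ?B = "eigenspan D (\<lambda>c. Re c < r)"
  have "diagonalizable D" using JC by (simp add: jordan_chevalley_def)
  then obtain z :: "'m \<Rightarrow> complex^'m" and c where b: "b = (\<Sum>i\<in>UNIV. z i)" and z: "\<And>i. D *v z i = c i *s z i"
    by (rule diagonalizable_eigendecomposition[where x = b]) blast
  define b1 where "b1 = (\<Sum>i | Re (c i) < r. z i)"
  define b2 where "b2 = (\<Sum>i | \<not> Re (c i) < r. z i)"
  have b12: "b = b1 + b2"
    unfolding b b1_def b2_def by (subst sum.union_disjoint[symmetric]) (auto intro: sum.cong)
  have b1: "b1 \<in> ?B"
    unfolding b1_def by (intro vec.span_sum eigenspan_memI[OF z]) auto
  have "z i \<in> eigenspan (- D) (\<lambda>c. Re c \<le> - r)" if "\<not> Re (c i) < r" for i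
    by (rule eigenspan_memI[of _ _ "- c i"]) (use that z in \<open>auto simp: uminus_matrix_vector\<close>)
  then have "b2 \<in> eigenspan (- D) (\<lambda>c. Re c \<le> - r)"
    unfolding b2_def by (intro vec.span_sum) auto
  from mat_exp_growth[OF jordan_chevalley_uminus[OF JC] this e]
  have "((\<lambda>t. (exp (- t * (- r + e)) *\<^sub>R (mat_exp (t *\<^sub>R (- A)) *v b2)) \<bullet> y) \<longlongrightarrow> 0 \<bullet> y) at_top"
    by (intro tendsto_inner tendsto_const)
  moreover have "(exp (- t * (- r + e)) *\<^sub>R (mat_exp (t *\<^sub>R (- A)) *v b2)) \<bullet> y
     = (exp (t * (r - e)) *\<^sub>R (conj_transpose (mat_exp (t *\<^sub>R (- A))) *v y)) \<bullet> b" for t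
  proof -
    \<comment> \<open>\<open>exp (- t A)\<close> keeps \<open>b1\<close> inside \<open>?B\<close>,
      to which \<open>y\<close> is orthogonal.\<close>
    have "(mat_exp (t *\<^sub>R (- A)) *v b1) \<bullet> y = 0"
      using y[OF mat_exp_eigenspan[OF JC b1, of "- t"]] by (simp add: inner_commute)
    then have "(mat_exp (t *\<^sub>R (- A)) *v b2) \<bullet> y = (mat_exp (t *\<^sub>R (- A)) *v b) \<bullet> y"
      by (simp add: b12 matrix_vector_right_distrib inner_add_left)
    also have "\<dots> = (conj_transpose (mat_exp (t *\<^sub>R (- A))) *v y) \<bullet> b"
      by (subst inner_conj_transpose) (rule inner_commute)
    finally show ?thesis by (simp add: algebra_simps)
  qed
  ultimately show "((\<lambda>t. (exp (t * (r - e)) *\<^sub>R (conj_transpose (mat_exp (t *\<^sub>R (- A))) *v y)) \<bullet> b) \<longlongrightarrow> 0 \<bullet> b) at_top"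
    by simp
qed

section \<open>Limits of the roots on a single block\<close>

lemma mat_exp_inverse:
  "mat_exp (t *\<^sub>R A) ** mat_exp (t *\<^sub>R (- A)) = mat 1" "mat_exp (t *\<^sub>R (- A)) ** mat_exp (t *\<^sub>R A) = mat 1"
  using mat_exp_neg[of "t *\<^sub>R A"] by simp_all

text \<open>In \<open>deviation_bound\<close> the first term does not depend on \<open>t\<close>:
  fix \<open>e\<close> so that it is small, then let \<open>t\<close> grow to make the other two
  vanish.\<close>

lemma mat_abs_powr_tendsto_on_block:
  fixes A D N :: "complex^'m^'m"
  assumes JC: "jordan_chevalley A D N" and x: "x \<in> eigenspan D (\<lambda>c. Re c \<le> r)"
    and orth: "\<And>w. w \<in> eigenspan D (\<lambda>c. Re c < r) \<Longrightarrow> x \<bullet> w = 0"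
  shows "((\<lambda>t. mat_powr (mat_abs (mat_exp (t *\<^sub>R A))) (1 / t) *v x) \<longlongrightarrow> exp r *\<^sub>R x) at_top"
proof (rule tendstoI)
  fix d :: real assume d: "d > 0"
  have "((\<lambda>e. (exp (r + e) - exp (r - e))\<^sup>2 * (norm x)\<^sup>2) \<longlongrightarrow> (exp (r + 0) - exp (r - 0))\<^sup>2 * (norm x)\<^sup>2) (at_right 0)"
    by (intro tendsto_intros)
  then have "\<forall>\<^sub>F e in at_right 0. (exp (r + e) - exp (r - e))\<^sup>2 * (norm x)\<^sup>2 < d\<^sup>2 / 2"
    using d by (intro order_tendstoD) auto
  from eventually_happens[OF eventually_conj[OF this eventually_at_right_less]]
  obtain e where e: "e > 0" and small: "(exp (r + e) - exp (r - e))\<^sup>2 * (norm x)\<^sup>2 < d\<^sup>2 / 2"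
    by auto
  let ?u = "\<lambda>t. exp (- t * (r + e)) *\<^sub>R (mat_exp (t *\<^sub>R A) *v x)"
  let ?l = "\<lambda>t. exp (t * (r - e)) *\<^sub>R (conj_transpose (mat_exp (t *\<^sub>R (- A))) *v x)"
  have "((\<lambda>t. exp (2 * (r + e)) * (norm (?u t))\<^sup>2 + exp (2 * r) * (norm (?l t))\<^sup>2)
      \<longlongrightarrow> exp (2 * (r + e)) * (norm (0 :: complex^'m))\<^sup>2 + exp (2 * r) * (norm (0 :: complex^'m))\<^sup>2) at_top"
    by (intro tendsto_add tendsto_mult tendsto_const tendsto_power tendsto_norm
        mat_exp_growth[OF JC x e] mat_exp_dual_growth[OF JC orth e])
  then have "\<forall>\<^sub>F t in at_top. exp (2 * (r + e)) * (norm (?u t))\<^sup>2 + exp (2 * r) * (norm (?l t))\<^sup>2 < d\<^sup>2 / 2"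
    using d by (intro order_tendstoD) auto
  with eventually_ge_at_top[of 1]
  show "\<forall>\<^sub>F t in at_top. dist (mat_powr (mat_abs (mat_exp (t *\<^sub>R A))) (1 / t) *v x) (exp r *\<^sub>R x) < d"
  proof eventually_elim
    case (elim t)
    have "(norm (mat_powr (mat_abs (mat_exp (t *\<^sub>R A))) (1 / t) *v x - exp r *\<^sub>R x))\<^sup>2 < d\<^sup>2"
      using deviation_bound[OF mat_exp_inverse[of t A] e elim(1), where h = r and x = x] elim(2) small by linarith
    then show ?case using d by (simp add: dist_norm power_less_imp_less_base)
  qed
qed

text \<open>The upper bound is \<open>mat_exp_growth\<close>. For the lower one,
  \<open>?E t *v x\<close> is paired with \<open>?G t *v y\<close>, where \<open>y\<close> is the
  part of \<open>x\<close> orthogonal to \<open>?B\<close>; the pairing is constant in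
  \<open>t\<close> while \<open>?G t *v y\<close> decays.\<close>

lemma norm_mat_exp_powr_tendsto:
  fixes A D N :: "complex^'m^'m"
  assumes JC: "jordan_chevalley A D N" and x: "x \<in> eigenspan D (\<lambda>c. Re c \<le> r)"
    and notin: "x \<notin> eigenspan D (\<lambda>c. Re c < r)"
  shows "((\<lambda>t. norm (mat_exp (t *\<^sub>R A) *v x) powr (1 / t)) \<longlongrightarrow> exp r) at_top"
proof -
  let ?B = "eigenspan D (\<lambda>c. Re c < r)"
  let ?E = "\<lambda>t. mat_exp (t *\<^sub>R A)"
  let ?G = "\<lambda>t. conj_transpose (mat_exp (t *\<^sub>R (- A)))"
  define y where "y = x - orth_proj ?B *v x"
  have in_B: "orth_proj ?B *v x \<in> ?B" by (rule orth_proj_in[OF vec.subspace_span])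
  have orth: "y \<bullet> w = 0" if "w \<in> ?B" for w
    unfolding y_def using vec.subspace_span that by (rule orth_proj_orthogonal)
  have "y \<noteq> 0" using in_B notin by (auto simp: y_def)
  then have y_pos: "(norm y)\<^sup>2 > 0" by (intro zero_less_power) simp
  have xy: "x \<bullet> y = (norm y)\<^sup>2"
    using orth[OF in_B] by (simp add: y_def power2_norm_eq_inner inner_diff_left inner_diff_right inner_commute)
  have pairing: "(norm y)\<^sup>2 \<le> norm (?E t *v x) * norm (?G t *v y)" for t
  proof -
    have "(?E t *v x) \<bullet> (?G t *v y) = (norm y)\<^sup>2"
      by (simp add: matrix_vector_mul_assoc mat_exp_neg xy flip: inner_conj_transpose)
    then show ?thesis using norm_cauchy_schwarz[of "?E t *v x" "?G t *v y"] by simp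
  qed
  have nz: "norm (?E t *v x) > 0" for t
    using pairing[of t] \<open>y \<noteq> 0\<close> by (metis mult_zero_left norm_ge_zero not_less order_less_le power2_less_eq_zero_iff norm_eq_zero zero_less_norm_iff)
  have "((\<lambda>t. 1 / t * ln (norm (?E t *v x))) \<longlongrightarrow> r) at_top"
  proof (rule tendstoI)
    fix d :: real assume d: "d > 0"
    then have e: "d / 2 > 0" by simp
    have "\<forall>\<^sub>F t in at_top. norm (exp (- t * (r + d / 2)) *\<^sub>R (?E t *v x)) < 1"
      using tendsto_norm_zero[OF mat_exp_growth[OF JC x e]] by (rule order_tendstoD) simp
    \<comment> \<open>The threshold \<open>(norm y)\<^sup>2\<close> is chosen to cancel against the
      left-hand side of \<open>pairing\<close>.\<close>
    moreover have "\<forall>\<^sub>F t in at_top. norm (exp (t * (r - d / 2)) *\<^sub>R (?G t *v y)) < (norm y)\<^sup>2"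
      using tendsto_norm_zero[OF mat_exp_dual_growth[OF JC orth e]] by (rule order_tendstoD) (rule y_pos | assumption)+
    moreover note eventually_gt_at_top[of 0]
    ultimately show "\<forall>\<^sub>F t in at_top. dist (1 / t * ln (norm (?E t *v x))) r < d"
    proof eventually_elim
      case (elim t)
      let ?n = "norm (?E t *v x)"
      have "exp (- (t * (r + d / 2))) * ?n < 1" using elim(1) by simp
      then have "?n \<le> exp (t * (r + d / 2))" by (simp add: exp_minus divide_simps split: if_splits)
      then have "ln ?n \<le> ln (exp (t * (r + d / 2)))" using nz[of t] by (intro ln_mono) auto
      then have "ln ?n \<le> t * (r + d / 2)" by simp
      moreover have "t * (r - d / 2) \<le> ln ?n"
      proof -
        have "exp (t * (r - d / 2)) * (norm y)\<^sup>2 \<le> exp (t * (r - d / 2)) * (?n * norm (?G t *v y))"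
          using pairing by simp
        also have "\<dots> = ?n * norm (exp (t * (r - d / 2)) *\<^sub>R (?G t *v y))" by simp
        also have "\<dots> \<le> ?n * (norm y)\<^sup>2" using elim(2) by (intro mult_left_mono) auto
        finally have "exp (t * (r - d / 2)) \<le> ?n" using \<open>y \<noteq> 0\<close> by simp
        then show ?thesis using nz[of t] by (simp add: ln_ge_iff)
      qed
      ultimately have "r - d / 2 \<le> 1 / t * ln ?n" "1 / t * ln ?n \<le> r + d / 2"
        using elim(3) by (simp_all add: divide_simps mult.commute)
      then show ?case using d by (simp add: dist_real_def abs_le_iff)
    qed
  qed
  then have "((\<lambda>t. exp (1 / t * ln (norm (?E t *v x)))) \<longlongrightarrow> exp r) at_top"
    by (rule tendsto_exp)
  \<comment> \<open>\<open>powr\<close> is the exponential of a logarithm only at a nonzero base,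
    which \<open>nz\<close> provides.\<close>
  then show ?thesis using nz by (simp add: powr_def less_imp_neq[symmetric] cong: if_cong)
qed

section \<open>The three assertions along the flag of spectral subspaces\<close>

theorem theorem4p1:
  fixes A D N :: "complex^'m^'m"
    and k :: nat and h :: "nat \<Rightarrow> real"
    and F :: "nat \<Rightarrow> complex^'m^'m"
  assumes h_set: "h ` {1..k} = Re ` eigenvalues A"
    and h_strict: "strict_mono_on {1..k} h"
    and JC: "jordan_chevalley A D N"
    and F_0: "F 0 = 0"
    and F_j: "\<And>j. j \<in> {1..k} \<Longrightarrow> F j = orth_proj (spectral_subspace D (h j))"
  shows "((\<lambda>t::real. mat_powr (mat_abs (mat_exp (t *\<^sub>R A))) (1 / t))
            \<longlongrightarrow> (\<Sum>j=1..k. exp (h j) *\<^sub>R (F j - F (j - 1)))) at_top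
       \<and> (\<forall>j\<in>{1..k}. \<forall>x::complex^'m. x \<noteq> 0 \<longrightarrow>
            (x \<in> mat_range (F j) - mat_range (F (j - 1)) \<longleftrightarrow>
             ((\<lambda>t::real. norm (mat_exp (t *\<^sub>R A) *v x) powr (1 / t)) \<longlongrightarrow> exp (h j)) at_top))
       \<and> (\<forall>j\<in>{1..k}. \<forall>s::real. s \<ge> 0 \<longrightarrow>
            (\<forall>x \<in> mat_range (F j) - mat_range (F (j - 1)).
               mat_exp (s *\<^sub>R A) *v x \<in> mat_range (F j) - mat_range (F (j - 1))))"
proof -
  \<comment> \<open>\<open>h 0\<close> carries no information, so the bottom of the flag is set to
    \<open>{0}\<close> by hand, matching \<open>F 0 = 0\<close>.\<close>
  define V where "V = (\<lambda>j. if j = 0 then {0} else eigenspan D (\<lambda>c. Re c \<le> h j))"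
  have h_less: "h i < h j" if "i \<in> {1..k}" "j \<in> {1..k}" "i < j" for i j
    using h_strict that by (auto simp: strict_mono_on_def)
  have h_inj: "i = j" if "i \<in> {1..k}" "j \<in> {1..k}" "h i = h j" for i j
    using h_less[of i j] h_less[of j i] that by (metis less_irrefl linorder_neqE_nat)
  have h_mono: "h i \<le> h j" if "i \<in> {1..k}" "j \<in> {1..k}" "i \<le> j" for i j
    using h_less[of i j] that by (cases "i = j") auto
  have eig: "\<exists>i\<in>{1..k}. Re c = h i" if "eigenvector D v c" for v c
    using jordan_chevalley_eigenvalue[OF JC that] h_set by (metis imageE imageI)
  have V_sub: "vec.subspace (V j)" for j by (simp add: V_def vec.subspace_span)
  have V_j: "V j = eigenspan D (\<lambda>c. Re c \<le> h j)" if "j \<in> {1..k}" for j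
    using that by (simp add: V_def)
  \<comment> \<open>No eigenvalue of \<open>D\<close> has real part strictly between
    \<open>h (j - 1)\<close> and \<open>h j\<close>, and for \<open>j = 1\<close> none lies below
    \<open>h 1\<close>; this links the flag to the strict spans of the limit lemmas.\<close>
  have V_pred: "V (j - 1) = eigenspan D (\<lambda>c. Re c < h j)" if j: "j \<in> {1..k}" for j
  proof (cases "j = 1")
    case True
    have "\<not> Re c < h 1" if "eigenvector D v c" for v c
      using eig[OF that] h_mono[of 1] j by (metis True atLeastAtMost_iff not_le)
    then have none: "{v. \<exists>c. Re c < h 1 \<and> eigenvector D v c} = {}" by blast
    show ?thesis unfolding True none by (simp add: V_def)
  next
    case False
    then have j1: "j - 1 \<in> {1..k}" using j by auto
    have "Re c \<le> h (j - 1) \<longleftrightarrow> Re c < h j" if "eigenvector D v c" for v c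
    proof -
      from eig[OF that] obtain i where i: "i \<in> {1..k}" "Re c = h i" by blast
      show ?thesis
      proof (cases "i < j")
        case True
        then show ?thesis using h_less[OF i(1) j] h_mono[OF i(1) j1] i by simp
      next
        case False
        then show ?thesis using h_mono[OF j i(1)] h_less[OF j1 j] j i by auto
      qed
    qed
    then have "{v. \<exists>c. Re c \<le> h (j - 1) \<and> eigenvector D v c} = {v. \<exists>c. Re c < h j \<and> eigenvector D v c}"
      by blast
    then show ?thesis using V_j[OF j1] by simp
  qed
  have V_step: "V (j - 1) \<subseteq> V j" if "j \<in> {1..k}" for j
    unfolding V_pred[OF that] V_j[OF that] by (rule eigenspan_mono) simp
  have V_k: "V k = UNIV"
  proof -
    have "x \<in> V k" for x
    proof -
      have "diagonalizable D" using JC by (simp add: jordan_chevalley_def)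
      then obtain y :: "'m \<Rightarrow> complex^'m" and c where x: "x = (\<Sum>i\<in>UNIV. y i)" and y: "\<And>i. D *v y i = c i *s y i"
        by (rule diagonalizable_eigendecomposition[where x = x]) blast
      have "y i \<in> V k" for i
      proof (cases "y i = 0")
        case False
        then have "eigenvector D (y i) (c i)" using y by (simp add: eigenvector_def)
        then obtain j where j: "j \<in> {1..k}" "Re (c i) = h j" using eig by blast
        \<comment> \<open>A nonzero component forces \<open>k \<ge> 1\<close>, so \<open>V k\<close>
          is a genuine span and not the default \<open>{0}\<close>.\<close>
        then have k: "k \<in> {1..k}" by simp
        show ?thesis
          unfolding V_j[OF k] using y h_mono[OF j(1) k] j by (intro eigenspan_memI) auto
      qed (simp add: vec.subspace_0 V_sub)
      then show ?thesis unfolding x by (intro vec.subspace_sum V_sub) auto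
    qed
    then show ?thesis by blast
  qed
  have F: "F j = orth_proj (V j)" if "j \<le> k" for j
  proof (cases "j = 0")
    case True
    have "orth_proj (V 0) *v x = 0" for x
      using orth_proj_in[OF V_sub, of 0 x] by (simp add: V_def)
    then show ?thesis by (simp add: True F_0 matrix_eq)
  qed (use that F_j V_j in \<open>simp add: spectral_subspace_def\<close>)
  have range_F: "mat_range (F j) = V j" if "j \<le> k" for j
    by (simp only: F[OF that] range_orth_proj[OF V_sub])
  have ranges: "mat_range (F j) - mat_range (F (j - 1)) = V j - V (j - 1)" if "j \<in> {1..k}" for j
  proof -
    have "j \<le> k" "j - 1 \<le> k" using that by auto
    then show ?thesis by (simp only: range_F)
  qed
  have limit: "((\<lambda>t. norm (mat_exp (t *\<^sub>R A) *v x) powr (1 / t)) \<longlongrightarrow> exp (h j)) at_top"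
    if "j \<in> {1..k}" "x \<in> V j - V (j - 1)" for j x
    using norm_mat_exp_powr_tendsto[OF JC] that V_j V_pred by simp

  have i: "((\<lambda>t::real. mat_powr (mat_abs (mat_exp (t *\<^sub>R A))) (1 / t))
            \<longlongrightarrow> (\<Sum>j=1..k. exp (h j) *\<^sub>R (F j - F (j - 1)))) at_top" (is "(?T \<longlongrightarrow> ?L) at_top")
  proof -
    define p where "p = (\<lambda>j. F j - F (j - 1))"
    \<comment> \<open>The differences telescope, so the vectors \<open>p j *v x\<close> add up to
      \<open>x\<close> and each lies in one block.\<close>
    have "(\<Sum>j=1..n. p j) = F n" for n by (induction n) (simp_all add: p_def F_0)
    moreover have "F k = mat 1"
      using orth_proj_inside[OF V_sub, of _ k] by (simp add: F V_k matrix_eq)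
    ultimately have p_sum: "(\<Sum>j=1..k. p j *v x) = x" for x
      by (simp flip: sum_matrix_vector)
    have block: "((\<lambda>t. ?T t *v (p j *v x)) \<longlongrightarrow> exp (h j) *\<^sub>R (p j *v x)) at_top" if j: "j \<in> {1..k}" for j x
    proof (rule mat_abs_powr_tendsto_on_block[OF JC])
      have le: "j \<le> k" "j - 1 \<le> k" using j by auto
      have px: "p j *v x = orth_proj (V j) *v x - orth_proj (V (j - 1)) *v x"
        by (simp only: p_def F[OF le(1)] F[OF le(2)] matrix_vector_mult_diff_rdistrib)
      show "p j *v x \<in> eigenspan D (\<lambda>c. Re c \<le> h j)"
        unfolding px V_j[OF j, symmetric]
        using orth_proj_in[OF V_sub] V_step[OF j] by (intro vec.subspace_diff V_sub) auto
      show "(p j *v x) \<bullet> w = 0" if w: "w \<in> eigenspan D (\<lambda>c. Re c < h j)" for w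
      proof -
        have w: "w \<in> V (j - 1)" "w \<in> V j" using w V_pred[OF j] V_step[OF j] by auto
        show ?thesis
          using orth_proj_orthogonal[OF V_sub w(1), of x] orth_proj_orthogonal[OF V_sub w(2), of x]
          by (simp add: px inner_diff_left)
      qed
    qed
    have "((\<lambda>t. ?T t *v x) \<longlongrightarrow> ?L *v x) at_top" for x
    proof -
      have "((\<lambda>t. \<Sum>j=1..k. ?T t *v (p j *v x)) \<longlongrightarrow> (\<Sum>j=1..k. exp (h j) *\<^sub>R (p j *v x))) at_top"
        by (intro tendsto_sum block)
      moreover have "(\<Sum>j=1..k. ?T t *v (p j *v x)) = ?T t *v x" for t
        by (simp only: p_sum flip: matrix_vector_sum)
      moreover have "(\<Sum>j=1..k. exp (h j) *\<^sub>R (p j *v x)) = ?L *v x"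
        by (simp add: sum_matrix_vector scaleR_matrix_vector p_def)
      ultimately show ?thesis by simp
    qed
    \<comment> \<open>Convergence on the standard basis vectors is convergence of every matrix
      entry, hence in norm.\<close>
    then have "((\<lambda>t. (?T t *v axis j 1) $ i) \<longlongrightarrow> (?L *v axis j 1) $ i) at_top" for i j
      by (intro tendsto_vec_nth)
    then show ?thesis
      by (intro vec_tendstoI) (simp add: matrix_vector_axis)
  qed

  have ii: "x \<in> V j - V (j - 1)"
    if j: "j \<in> {1..k}" and "x \<noteq> 0"
      and lim: "((\<lambda>t. norm (mat_exp (t *\<^sub>R A) *v x) powr (1 / t)) \<longlongrightarrow> exp (h j)) at_top" for j x
  proof -
    \<comment> \<open>The least \<open>n\<close> names the block containing \<open>x\<close>. Its
      limit \<open>exp (h n)\<close> is already known, so uniqueness of limits and injectivity of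
      \<open>h\<close> give \<open>n = j\<close>.\<close>
    define n where "n = (LEAST n. x \<in> V n)"
    have n: "x \<in> V n" "n \<le> k"
      unfolding n_def using V_k by (auto intro: LeastI Least_le)
    have "n \<noteq> 0"
    proof
      assume "n = 0"
      with n(1) \<open>x \<noteq> 0\<close> show False by (simp add: V_def)
    qed
    then have "n \<in> {1..k}" "x \<in> V n - V (n - 1)"
      using n not_less_Least[of "n - 1" "\<lambda>n. x \<in> V n"] by (auto simp: n_def)
    then show ?thesis
      using tendsto_unique[OF _ limit lim] h_inj[OF _ j] by force
  qed

  have iii: "mat_exp (s *\<^sub>R A) *v x \<in> V j - V (j - 1)"
    if j: "j \<in> {1..k}" and x: "x \<in> V j - V (j - 1)" for j s x
  proof -
    have "mat_exp (s *\<^sub>R A) *v x \<in> V j"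
      using x unfolding V_j[OF j] by (intro mat_exp_eigenspan[OF JC]) simp
    \<comment> \<open>The inverse exponential preserves \<open>V (j - 1)\<close> too, so an image in
      it could only come from a vector in it.\<close>
    moreover have "x \<in> V (j - 1)" if "mat_exp (s *\<^sub>R A) *v x \<in> V (j - 1)"
      using mat_exp_eigenspan[OF JC that[unfolded V_pred[OF j]], of "- s"] mat_exp_neg[of "s *\<^sub>R A"]
      unfolding V_pred[OF j] by (simp add: matrix_vector_mul_assoc)
    ultimately show ?thesis using x by blast
  qed

  show ?thesis
    by (intro conjI ballI allI impI i; unfold ranges) (rule iffI ii iii limit; assumption?)+
qed

end
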